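(* There is a constant $C$ independent of $\tau$ such that the iterates of the splitting scheme satisfy $\frac1{2\tau}\sum_{n=0}^{N-1}\Big[W_2^2(\rho^{n+1/2},\rho^{n+1})+W_2^2(\eta^{n+1/2},\eta^{n+1})\Big]\le C$.
   Context: Setting. $\Omega\subset\mathbb R$ is a bounded open interval and $T>0$. $BV(\Omega)$ is the space of functions $f:\bar\Omega\to\mathbb R$ with finite total variation $|f|_{BV}:=\sup_P\sum_{i=1}^{|P|-1}|f(x_{i+1})-f(x_i)|$, the supremum over finite partitions $P=\{x_1<\dots<x_{|P|}\}\subset\Omega$. A function $\chi:[0,\infty)\to\mathbb R$ is an internal energy density: $\chi\in C^0([0,\infty))\cap C^2((0,\infty))$, $\chi''>0$ on $(0,\infty)$, $\lim_{h\downarrow0}\chi'(h)=0$, and the integrals $\kappa(x):=\int_1^x\frac{\chi''(s)}{s}\,ds$ and $K(\sigma):=\int_0^\sigma\kappa(x)\,dx$ exist. Put $\mathcal K(\sigma):=\int_\Omega K(\sigma)\,dx$ and $\mathcal E(\rho,\eta):=\int_\Omega\chi(\rho+\eta)\,dx$. The functions $F_1,F_2,G_1,G_2:[0,\infty)^2\to\mathbb R$ are bounded and Lipschitz, with $G_1(0,\eta)\ge0$ for all $\eta\ge0$ and $G_2(\rho,0)\ge0$ for all $\rho\ge0$. For $\sigma\ge0$, $r\in[0,1]$ set $\tilde F_i(\sigma,r)=F_i(r\sigma,(1-r)\sigma)$, $\tilde G_i(\sigma,r)=G_i(r\sigma,(1-r)\sigma)$, $A_1=\tilde F_1+\tilde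 G_2$, $A_2=\tilde G_1+\tilde F_2$, $A_3=\tilde F_1-\tilde F_2$, $\Sigma(\sigma,r)=\sigma(rA_1+(1-r)A_2)$, $R(\sigma,r)=r(1-r)A_3+(1-r)^2\tilde G_1-r^2\tilde G_2$. Initial data: $\rho_0,\eta_0\in BV(\Omega)\cap L^\infty(\Omega)$ nonnegative, $\sigma_0=\rho_0+\eta_0$, and $r_0\in BV(\Omega)$ with $0\le r_0\le1$ and $r_0=\rho_0/\sigma_0$ on $\{\sigma_0>0\}$. For $m>0$, $\mathcal P^m(\Omega)$ is the set of nonnegative Borel measures on $\Omega$ of total mass $m$; $W_p$ ($p=1,2$) is the $p$-Wasserstein distance between measures of equal mass, $W_p^p(\mu,\nu)=\inf_\gamma\int|x-y|^p\,d\gamma$ over couplings $\gamma$ of $\mu,\nu$. Splitting scheme. Fix $\tau\in(0,1)$ and $N\in\mathbb N$ with $N\tau=T$; set $r^0=r_0$, $\sigma^0=\sigma_0$. For $n=0,\dots,N-1$: (Reaction step) for each $x\in\Omega$ solve $\dot\sigma=\Sigma(\sigma,r)$, $\dot r=R(\sigma,r)$ on $[0,\tau]$ with $\sigma(0)=\sigma^n(x)$, $r(0)=r^n(x)$, and set $\sigma^{n+1/2}(x)=\sigma(\tau)$, $r^{n+1/2}(x)=r(\tau)$, $\rho^{n+1/2}=r^{n+1/2}\sigma^{n+1/2}$, $\eta^{n+1/2}=(1-r^{n+1/2})\sigma^{n+1/2}$, $U^{n+1/2}=(\rho^{n+1/2},\eta^{n+1/2})$. (Diffusion step) with $m_1=\int_\Omega\rho^{n+1/2}$,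 $m_2=\int_\Omega\eta^{n+1/2}$, let $U^{n+1}=(\rho^{n+1},\eta^{n+1})$ be a minimiser over $(\rho,\eta)\in\mathcal P^{m_1}(\Omega)\times\mathcal P^{m_2}(\Omega)$ of $\frac1{2\tau}\big[W_2^2(\rho,\rho^{n+1/2})+W_2^2(\eta,\eta^{n+1/2})\big]+\mathcal E(\rho,\eta)$; set $\sigma^{n+1}=\rho^{n+1}+\eta^{n+1}$ and $r^{n+1}=r^{n+1/2}\circ\mathcal T$, where $\mathcal T$ is the nondecreasing optimal transport map pushing $\sigma^{n+1}$ forward to $\sigma^{n+1/2}$. Also $\rho^n=r^n\sigma^n$, $\eta^n=(1-r^n)\sigma^n$, $U^n=(\rho^n,\eta^n)$. Piecewise constant interpolation: for $t\in[n\tau,(n+1)\tau)$, $r_\tau(t)=r^n$, $\sigma_\tau(t)=\sigma^n$, $\rho_\tau(t)=r^n\sigma^n$, $\eta_\tau(t)=(1-r^n)\sigma^n$, $U_\tau=(\rho_\tau,\eta_\tau)$. *)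

theory Defs
  imports "HOL-Analysis.Analysis"
begin

definition has_bv :: "real \<Rightarrow> real \<Rightarrow> (real \<Rightarrow> real) \<Rightarrow> bool" where
  "has_bv a b f \<longleftrightarrow> (\<exists>M. \<forall>(k::nat) (x::nat \<Rightarrow> real).
      (\<forall>i<k. a < x i \<and> x i < b) \<and> (\<forall>i. Suc i < k \<longrightarrow> x i < x (Suc i)) \<longrightarrow>
      (\<Sum>i | Suc i < k. \<bar>f (x (Suc i)) - f (x i)\<bar>) \<le> M)"

definition kappa :: "(real \<Rightarrow> real) \<Rightarrow> real \<Rightarrow> real" where
  "kappa chi x = (if 1 \<le> x then integral {1..x} (\<lambda>s. deriv (deriv chi) s / s)
                 else - integral {x..1} (\<lambda>s. deriv (deriv chi) s / s))"

definition internal_energy_density :: "(real \<Rightarrow> real) \<Rightarrow> bool" where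
  "internal_energy_density chi \<longleftrightarrow>
     continuous_on {0..} chi \<and>
     (\<forall>x>0. chi differentiable (at x)) \<and>
     (\<forall>x>0. deriv chi differentiable (at x)) \<and>
     continuous_on {0<..} (deriv (deriv chi)) \<and>
     (\<forall>x>0. deriv (deriv chi) x > 0) \<and>
     ((deriv chi) \<longlongrightarrow> 0) (at_right 0) \<and>
     (\<forall>x>0. (\<lambda>s. deriv (deriv chi) s / s) integrable_on {min 1 x..max 1 x}) \<and>
     (\<forall>\<sigma>\<ge>0. kappa chi integrable_on {0..\<sigma>})"

text \<open>Coefficients of the reaction ODE in the (sigma, r) variables.\<close>
definition SigmaR :: "(real \<times> real \<Rightarrow> real) \<Rightarrow> (real \<times> real \<Rightarrow> real) \<Rightarrow>
    (real \<times> real \<Rightarrow> real) \<Rightarrow> (real \<times> real \<Rightarrow> real) \<Rightarrow> real \<Rightarrow> real \<Rightarrow> real" where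
  "SigmaR F1 F2 G1 G2 \<sigma> r =
     (let p = (r * \<sigma>, (1 - r) * \<sigma>);
          A1 = F1 p + G2 p; A2 = G1 p + F2 p
      in \<sigma> * (r * A1 + (1 - r) * A2))"

definition RR :: "(real \<times> real \<Rightarrow> real) \<Rightarrow> (real \<times> real \<Rightarrow> real) \<Rightarrow>
    (real \<times> real \<Rightarrow> real) \<Rightarrow> (real \<times> real \<Rightarrow> real) \<Rightarrow> real \<Rightarrow> real \<Rightarrow> real" where
  "RR F1 F2 G1 G2 \<sigma> r =
     (let p = (r * \<sigma>, (1 - r) * \<sigma>);
          A3 = F1 p - F2 p
      in r * (1 - r) * A3 + (1 - r)^2 * G1 p - r^2 * G2 p)"

definition reaction_step :: "(real \<times> real \<Rightarrow> real) \<Rightarrow> (real \<times> real \<Rightarrow> real) \<Rightarrow>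
    (real \<times> real \<Rightarrow> real) \<Rightarrow> (real \<times> real \<Rightarrow> real) \<Rightarrow> real \<Rightarrow>
    real \<Rightarrow> real \<Rightarrow> real \<Rightarrow> real \<Rightarrow> bool" where
  "reaction_step F1 F2 G1 G2 \<tau> s0 q0 s1 q1 \<longleftrightarrow>
     (\<exists>s q :: real \<Rightarrow> real. s 0 = s0 \<and> q 0 = q0 \<and> s \<tau> = s1 \<and> q \<tau> = q1 \<and>
        (\<forall>t\<in>{0..\<tau>}. 0 \<le> s t \<and> 0 \<le> q t \<and> q t \<le> 1 \<and>
           (s has_real_derivative SigmaR F1 F2 G1 G2 (s t) (q t)) (at t within {0..\<tau>}) \<and>
           (q has_real_derivative RR F1 F2 G1 G2 (s t) (q t)) (at t within {0..\<tau>})))"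

definition dmeas :: "real \<Rightarrow> real \<Rightarrow> (real \<Rightarrow> real) \<Rightarrow> real measure" where
  "dmeas a b f = density lborel (\<lambda>x. ennreal (indicator {a<..<b} x * f x))"

definition couplings :: "real measure \<Rightarrow> real measure \<Rightarrow> (real \<times> real) measure set" where
  "couplings \<mu> \<nu> = {\<gamma>. sets \<gamma> = sets (borel :: (real \<times> real) measure) \<and>
                       distr \<gamma> borel fst = \<mu> \<and> distr \<gamma> borel snd = \<nu>}"

definition W2sq :: "real measure \<Rightarrow> real measure \<Rightarrow> ennreal" where
  "W2sq \<mu> \<nu> = (INF \<gamma>\<in>couplings \<mu> \<nu>. \<integral>\<^sup>+ z. ennreal ((fst z - snd z)^2) \<partial>\<gamma>)"

definition admissible :: "real \<Rightarrow> real \<Rightarrow> real \<Rightarrow> (real \<Rightarrow> real) \<Rightarrow> bool" where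
  "admissible a b m f \<longleftrightarrow> f \<in> borel_measurable borel \<and> (\<forall>x\<in>{a<..<b}. 0 \<le> f x) \<and>
     set_integrable lborel {a<..<b} f \<and> (\<integral>x\<in>{a<..<b}. f x \<partial>lborel) = m"

text \<open>Internal energy E(rho,eta) = int_Omega chi(rho+eta); +infinity if not integrable
  (chi is bounded below on [0,infinity)).\<close>
definition energy :: "real \<Rightarrow> real \<Rightarrow> (real \<Rightarrow> real) \<Rightarrow> (real \<Rightarrow> real) \<Rightarrow> (real \<Rightarrow> real) \<Rightarrow> ereal" where
  "energy a b chi \<rho> \<eta> =
     (if set_integrable lborel {a<..<b} (\<lambda>x. chi (\<rho> x + \<eta> x))
      then ereal (\<integral>x\<in>{a<..<b}. chi (\<rho> x + \<eta> x) \<partial>lborel) else \<infinity>)"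

definition jko_functional :: "real \<Rightarrow> real \<Rightarrow> (real \<Rightarrow> real) \<Rightarrow> real \<Rightarrow>
    (real \<Rightarrow> real) \<Rightarrow> (real \<Rightarrow> real) \<Rightarrow> (real \<Rightarrow> real) \<Rightarrow> (real \<Rightarrow> real) \<Rightarrow> ereal" where
  "jko_functional a b chi \<tau> \<rho>h \<eta>h \<rho> \<eta> =
     ereal (1 / (2 * \<tau>)) * enn2ereal (W2sq (dmeas a b \<rho>) (dmeas a b \<rho>h) + W2sq (dmeas a b \<eta>) (dmeas a b \<eta>h))
     + energy a b chi \<rho> \<eta>"

definition jko_minimiser :: "real \<Rightarrow> real \<Rightarrow> (real \<Rightarrow> real) \<Rightarrow> real \<Rightarrow>
    (real \<Rightarrow> real) \<Rightarrow> (real \<Rightarrow> real) \<Rightarrow> (real \<Rightarrow> real) \<Rightarrow> (real \<Rightarrow> real) \<Rightarrow> bool" where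
  "jko_minimiser a b chi \<tau> \<rho>h \<eta>h \<rho> \<eta> \<longleftrightarrow>
     (let m1 = (\<integral>x\<in>{a<..<b}. \<rho>h x \<partial>lborel); m2 = (\<integral>x\<in>{a<..<b}. \<eta>h x \<partial>lborel) in
      admissible a b m1 \<rho> \<and> admissible a b m2 \<eta> \<and>
      (\<forall>\<rho>' \<eta>'. admissible a b m1 \<rho>' \<and> admissible a b m2 \<eta>' \<longrightarrow>
          jko_functional a b chi \<tau> \<rho>h \<eta>h \<rho> \<eta> \<le> jko_functional a b chi \<tau> \<rho>h \<eta>h \<rho>' \<eta>'))"

definition monotone_ot_map :: "real \<Rightarrow> real \<Rightarrow> (real \<Rightarrow> real) \<Rightarrow> (real \<Rightarrow> real) \<Rightarrow> (real \<Rightarrow> real) \<Rightarrow> bool" where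
  "monotone_ot_map a b \<sigma>1 \<sigma>0 T \<longleftrightarrow>
     T \<in> borel_measurable borel \<and> mono_on {a..b} T \<and> T ` {a..b} \<subseteq> {a..b} \<and>
     distr (dmeas a b \<sigma>1) borel T = dmeas a b \<sigma>0 \<and>
     (\<integral>\<^sup>+ x. ennreal ((x - T x)^2) \<partial>(dmeas a b \<sigma>1)) = W2sq (dmeas a b \<sigma>1) (dmeas a b \<sigma>0)"

text \<open>The splitting scheme with step tau and N steps.
  sig n, r n : sigma^n, r^n (n <= N);  sigh n, rh n : sigma^{n+1/2}, r^{n+1/2} (n < N);
  rhoD n, etaD n : the minimiser U^{n+1} of the n-th diffusion step; Tm n : transport map.\<close>
definition splitting_scheme ::
  "real \<Rightarrow> real \<Rightarrow> (real \<Rightarrow> real) \<Rightarrow> (real \<times> real \<Rightarrow> real) \<Rightarrow> (real \<times> real \<Rightarrow> real) \<Rightarrow>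
   (real \<times> real \<Rightarrow> real) \<Rightarrow> (real \<times> real \<Rightarrow> real) \<Rightarrow>
   (real \<Rightarrow> real) \<Rightarrow> (real \<Rightarrow> real) \<Rightarrow> (real \<Rightarrow> real) \<Rightarrow> real \<Rightarrow> nat \<Rightarrow>
   (nat \<Rightarrow> real \<Rightarrow> real) \<Rightarrow> (nat \<Rightarrow> real \<Rightarrow> real) \<Rightarrow> (nat \<Rightarrow> real \<Rightarrow> real) \<Rightarrow> (nat \<Rightarrow> real \<Rightarrow> real) \<Rightarrow>
   (nat \<Rightarrow> real \<Rightarrow> real) \<Rightarrow> (nat \<Rightarrow> real \<Rightarrow> real) \<Rightarrow> (nat \<Rightarrow> real \<Rightarrow> real) \<Rightarrow> bool" where
  "splitting_scheme a b chi F1 F2 G1 G2 \<rho>0 \<eta>0 r0 \<tau> N sig r sigh rh rhoD etaD Tm \<longleftrightarrow>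
     (\<forall>x\<in>{a..b}. sig 0 x = \<rho>0 x + \<eta>0 x \<and> r 0 x = r0 x) \<and>
     (\<forall>n<N.
        (\<forall>x\<in>{a..b}. reaction_step F1 F2 G1 G2 \<tau> (sig n x) (r n x) (sigh n x) (rh n x)) \<and>
        jko_minimiser a b chi \<tau> (\<lambda>x. rh n x * sigh n x) (\<lambda>x. (1 - rh n x) * sigh n x)
           (rhoD n) (etaD n) \<and>
        (\<forall>x\<in>{a..b}. sig (Suc n) x = rhoD n x + etaD n x) \<and>
        monotone_ot_map a b (sig (Suc n)) (sigh n) (Tm n) \<and>
        (\<forall>x\<in>{a..b}. r (Suc n) x = rh n (Tm n x)))"

end

theory Submission
  imports Defs
begin

text \<open>The diffusion step is compared with the trivial competitor \<open>U\<^bsup>n+1/2\<^esup>\<close>, so its transport cost is at most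
  the drop of the internal energy, and the sum telescopes up to the energy gained in the reaction steps.
  As \<open>chi\<close> may grow arbitrarily fast, that gain is \<open>O(\<tau>)\<close> only thanks to a uniform bound on \<open>\<sigma>\<^bsup>n\<^esup>\<close>.
  The reaction multiplies \<open>\<sigma>\<close> by at most \<open>exp (2 B \<tau>)\<close>, and the diffusion step obeys a maximum principle:
  if \<open>\<rho> + \<eta>\<close> exceeded the previous bound on a set of positive measure, returning a small fraction of the mass
  that has been transported into that set would not raise the transport cost but would strictly lower the energy.\<close>

section \<open>Functions of bounded variation and internal energy densities\<close>

lemma has_bv_borel_measurable:
  assumes "has_bv a b f"
  shows "f \<in> borel_measurable (restrict_space borel {a..b})"
proof -
  obtain M where M: "\<And>(k::nat) (x::nat \<Rightarrow> real). (\<forall>i<k. a < x i \<and> x i < b) \<Longrightarrow>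
      (\<forall>i. Suc i < k \<longrightarrow> x i < x (Suc i)) \<Longrightarrow> (\<Sum>i | Suc i < k. \<bar>f (x (Suc i)) - f (x i)\<bar>) \<le> M"
    using assms unfolding has_bv_def by blast
  define P where "P y k p \<longleftrightarrow> (\<forall>i\<le>k. a < p i \<and> p i < b) \<and> (\<forall>i<k. p i < p (Suc i)) \<and> p k = y"
    for y k and p :: "nat \<Rightarrow> real"
  define S where "S y = {(\<Sum>i<k. \<bar>f (p (Suc i)) - f (p i)\<bar>) | k p. P y k p}" for y
  define V where "V y = Sup (S y)" for y
  have bdd: "bdd_above (S y)" for y
  proof (rule bdd_aboveI)
    fix v assume "v \<in> S y"
    then obtain k p where kp: "P y k p" "v = (\<Sum>i<k. \<bar>f (p (Suc i)) - f (p i)\<bar>)"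
      unfolding S_def by blast
    have "{i. Suc i < Suc k} = {..<k}" by auto
    then show "v \<le> M" using M[of "Suc k" p] kp unfolding P_def by (auto simp: less_Suc_eq_le)
  qed
  have step: "V x + \<bar>f y - f x\<bar> \<le> V y" if "a < x" "x < y" "y < b" for x y
  proof -
    have "V x \<le> V y - \<bar>f y - f x\<bar>"
      unfolding V_def[of x]
    proof (rule cSup_least)
      have "P x 0 (\<lambda>_. x)" using that by (auto simp: P_def)
      then show "S x \<noteq> {}" unfolding S_def by blast
    next
      fix v assume "v \<in> S x"
      then obtain k p where kp: "P x k p" "v = (\<Sum>i<k. \<bar>f (p (Suc i)) - f (p i)\<bar>)"
        unfolding S_def by blast
      have "P y (Suc k) (p(Suc k := y))"
        using kp(1) that by (auto simp: P_def le_Suc_eq less_Suc_eq)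
      moreover have "(\<Sum>i<Suc k. \<bar>f ((p(Suc k := y)) (Suc i)) - f ((p(Suc k := y)) i)\<bar>)
          = v + \<bar>f y - f x\<bar>"
        using kp by (simp add: P_def)
      ultimately have "v + \<bar>f y - f x\<bar> \<in> S y"
        unfolding S_def by (intro CollectI exI[of _ "Suc k"] exI[of _ "p(Suc k := y)"]) simp
      then have "v + \<bar>f y - f x\<bar> \<le> V y" unfolding V_def by (rule cSup_upper[OF _ bdd])
      then show "v \<le> V y - \<bar>f y - f x\<bar>" by simp
    qed
    then show ?thesis by simp
  qed
  have "mono_on {a<..<b} V"
  proof (rule mono_onI)
    fix x y assume *: "x \<in> {a<..<b}" "y \<in> {a<..<b}" "x \<le> y"
    show "V x \<le> V y"
    proof (cases "x = y")
      case False
      then show ?thesis using step[of x y] * by auto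
    qed simp
  qed
  moreover have "mono_on {a<..<b} (\<lambda>x. V x - f x)"
  proof (rule mono_onI)
    fix x y assume *: "x \<in> {a<..<b}" "y \<in> {a<..<b}" "x \<le> y"
    show "V x - f x \<le> V y - f y"
    proof (cases "x = y")
      case False
      then show ?thesis using step[of x y] * by auto
    qed simp
  qed
  ultimately have "(\<lambda>x. V x - (V x - f x)) \<in> borel_measurable (restrict_space borel {a<..<b})"
    by (intro borel_measurable_diff borel_measurable_mono_on_fnc)
  then have [measurable]: "(\<lambda>x. indicator {a<..<b} x * f x) \<in> borel_measurable borel"
    by (simp add: borel_measurable_restrict_space_iff)
  have [measurable]: "{a} \<in> sets borel" "{b} - {a} \<in> sets borel" by auto
  have "(\<lambda>x. indicator {a<..<b} x * f x) \<in> borel_measurable (restrict_space borel {a..b})"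
    "(\<lambda>x. indicator {a} x * f a + indicator ({b} - {a}) x * f b) \<in> borel_measurable (restrict_space borel {a..b})"
    by (rule measurable_restrict_space1, measurable)+
  then have "(\<lambda>x. indicator {a<..<b} x * f x + (indicator {a} x * f a + indicator ({b} - {a}) x * f b))
      \<in> borel_measurable (restrict_space borel {a..b})"
    by (rule borel_measurable_add)
  then show ?thesis
    by (rule measurable_cong[THEN iffD1, rotated]) (auto simp: space_restrict_space indicator_def)
qed

lemma internal_energy_densityD:
  assumes "internal_energy_density chi"
  shows "continuous_on {0..} chi"
    and "\<And>x. 0 < x \<Longrightarrow> (chi has_real_derivative deriv chi x) (at x)"
    and "\<And>x y. 0 < x \<Longrightarrow> x < y \<Longrightarrow> deriv chi x < deriv chi y"
    and "\<And>x. 0 < x \<Longrightarrow> 0 < deriv chi x"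
proof -
  note d = assms[unfolded internal_energy_density_def]
  show "continuous_on {0..} chi" using d by blast
  show 1: "(chi has_real_derivative deriv chi x) (at x)" if "0 < x" for x
    using d that DERIV_deriv_iff_real_differentiable by blast
  show 2: "deriv chi x < deriv chi y" if "0 < x" "x < y" for x y
  proof (rule DERIV_pos_imp_increasing[OF \<open>x < y\<close>])
    fix z assume "x \<le> z" "z \<le> y"
    then show "\<exists>l. (deriv chi has_real_derivative l) (at z) \<and> 0 < l"
      using d that DERIV_deriv_iff_real_differentiable by (metis less_le_trans)
  qed
  have 3: "0 \<le> deriv chi x" if "0 < x" for x
  proof (rule tendsto_upperbound)
    show "(deriv chi \<longlongrightarrow> 0) (at_right 0)" using d by blast
    show "\<forall>\<^sub>F y in at_right 0. deriv chi y \<le> deriv chi x"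
      using eventually_at_right_less[of 0] that 2
      by (auto simp: eventually_at_right[OF that] intro!: exI[of _ x] less_imp_le)
  qed simp
  show "0 < deriv chi x" if "0 < x" for x
    using 3[of "x/2"] 2[of "x/2" x] that by simp
qed

lemma internal_energy_density_mean_value:
  assumes "internal_energy_density chi" "0 \<le> x" "x < y"
  obtains z where "x < z" "z < y" "chi y - chi x = (y - x) * deriv chi z"
proof -
  have "continuous_on {x..y} chi"
    using internal_energy_densityD(1)[OF assms(1)] assms(2) by (auto intro: continuous_on_subset)
  moreover have "(chi has_derivative (\<lambda>h. deriv chi z * h)) (at z)" if "x < z" "z < y" for z
    using internal_energy_densityD(2)[OF assms(1), of z] that assms
    by (simp add: has_field_derivative_def)
  ultimately obtain z where "x < z" "z < y" "chi y - chi x = deriv chi z * (y - x)"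
    using mvt[OF assms(3), of chi "\<lambda>z h. deriv chi z * h"] by blast
  then show ?thesis using that by (simp add: mult.commute)
qed

lemma internal_energy_density_mono:
  assumes "internal_energy_density chi" "0 \<le> x" "x \<le> y"
  shows "chi x \<le> chi y"
proof (cases "x = y")
  case False
  then have "x < y" using assms by simp
  from internal_energy_density_mean_value[OF assms(1,2) this] obtain z
    where "x < z" "z < y" "chi y - chi x = (y - x) * deriv chi z" .
  moreover have "0 < deriv chi z" using internal_energy_densityD(4)[OF assms(1)] assms \<open>x < z\<close> by simp
  ultimately have "0 \<le> chi y - chi x" using \<open>x < y\<close> by simp
  then show ?thesis by simp
qed simp

lemma internal_energy_density_increment_le:
  assumes "internal_energy_density chi" "0 \<le> x" "x \<le> y" "y \<le> u"
  shows "chi y - chi x \<le> (y - x) * deriv chi u"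
proof (cases "x = y")
  case False
  then have "x < y" using assms by simp
  from internal_energy_density_mean_value[OF assms(1,2) this] obtain z
    where "x < z" "z < y" "chi y - chi x = (y - x) * deriv chi z" .
  moreover have "deriv chi z \<le> deriv chi u"
    using internal_energy_densityD(3)[OF assms(1), of z u] assms calculation by simp
  ultimately show ?thesis using \<open>x < y\<close> by (simp add: mult_left_mono)
qed simp

lemma internal_energy_density_increment_ge:
  assumes "internal_energy_density chi" "0 < l" "l \<le> x" "x \<le> y"
  shows "(y - x) * deriv chi l \<le> chi y - chi x"
proof (cases "x = y")
  case False
  then have xy: "0 \<le> x" "x < y" using assms by auto
  from internal_energy_density_mean_value[OF assms(1) this] obtain z
    where "x < z" "z < y" "chi y - chi x = (y - x) * deriv chi z" .
  moreover have "deriv chi l \<le> deriv chi z"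
    using internal_energy_densityD(3)[OF assms(1), of l z] assms calculation by simp
  ultimately show ?thesis using xy by (simp add: mult_left_mono)
qed simp

lemma internal_energy_density_measurable:
  assumes "internal_energy_density chi" "f \<in> borel_measurable N" "\<And>x. x \<in> space N \<Longrightarrow> 0 \<le> f x"
  shows "(\<lambda>x. chi (f x)) \<in> borel_measurable N"
  by (rule measurable_compose[OF _ borel_measurable_continuous_on_restrict[OF internal_energy_densityD(1)[OF assms(1)]]])
    (use assms in \<open>auto intro!: measurable_restrict_space2\<close>)

section \<open>The reaction flow\<close>

lemma gronwall_exp_bound:
  fixes u u' :: "real \<Rightarrow> real"
  assumes der: "\<And>t. t \<in> {0..\<tau>} \<Longrightarrow> (u has_real_derivative u' t) (at t within {0..\<tau>})"
    and le: "\<And>t. t \<in> {0..\<tau>} \<Longrightarrow> u' t \<le> K * u t"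
    and t: "t \<in> {0..\<tau>}"
  shows "u t \<le> u 0 * exp (K * t)"
proof -
  define g where "g x = u x * exp (- K * x)" for x
  have g: "(g has_real_derivative (u' x - K * u x) * exp (- K * x)) (at x within {0..\<tau>})"
    if "x \<in> {0..\<tau>}" for x
    unfolding g_def using der[OF that]
    by (auto intro!: derivative_eq_intros simp: algebra_simps)
  have "g t \<le> g 0"
  proof (rule DERIV_nonpos_imp_decreasing_open[of 0 t g])
    show "0 \<le> t" using t by simp
    have "continuous_on {0..\<tau>} g"
      using g by (meson DERIV_continuous continuous_on_eq_continuous_within)
    then show "continuous_on {0..t} g"
      by (rule continuous_on_subset) (use t in auto)
    fix x assume x: "0 < x" "x < t"
    then have "at x within {0..\<tau>} = at x" using t by (intro at_within_Icc_at) auto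
    then have "(g has_real_derivative (u' x - K * u x) * exp (- K * x)) (at x)"
      using g[of x] x t by auto
    moreover have "(u' x - K * u x) * exp (- K * x) \<le> 0"
      using le[of x] x t by (intro mult_nonpos_nonneg) auto
    ultimately show "\<exists>y. (g has_real_derivative y) (at x) \<and> y \<le> 0" by blast
  qed
  then show ?thesis
    by (simp add: g_def exp_minus field_simps)
qed

definition bounded_lipschitz_on :: "(real \<times> real) set \<Rightarrow> (real \<times> real \<Rightarrow> real) \<Rightarrow> bool" where
  "bounded_lipschitz_on D f \<longleftrightarrow>
     (\<exists>B L. \<forall>z\<in>D. \<bar>f z\<bar> \<le> B \<and> (\<forall>w\<in>D. \<bar>f z - f w\<bar> \<le> L * dist z w))"

lemma bounded_lipschitz_onE:
  assumes "bounded_lipschitz_on D f"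
  obtains B L where "0 \<le> B" "0 \<le> L" "\<And>z. z \<in> D \<Longrightarrow> \<bar>f z\<bar> \<le> B"
    "\<And>z w. z \<in> D \<Longrightarrow> w \<in> D \<Longrightarrow> \<bar>f z - f w\<bar> \<le> L * dist z w"
proof -
  obtain B L where BL: "\<And>z. z \<in> D \<Longrightarrow> \<bar>f z\<bar> \<le> B"
    "\<And>z w. z \<in> D \<Longrightarrow> w \<in> D \<Longrightarrow> \<bar>f z - f w\<bar> \<le> L * dist z w"
    using assms unfolding bounded_lipschitz_on_def by blast
  have "\<bar>f z\<bar> \<le> max B 0" if "z \<in> D" for z using BL(1)[OF that] by simp
  moreover have "\<bar>f z - f w\<bar> \<le> max L 0 * dist z w" if "z \<in> D" "w \<in> D" for z w
    using BL(2)[OF that] mult_right_mono[of L "max L 0" "dist z w"] by simp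
  ultimately show ?thesis using that[of "max B 0" "max L 0"] by simp
qed

lemma bounded_lipschitz_onI:
  assumes "\<And>z. z \<in> D \<Longrightarrow> \<bar>f z\<bar> \<le> B"
    "\<And>z w. z \<in> D \<Longrightarrow> w \<in> D \<Longrightarrow> \<bar>f z - f w\<bar> \<le> L * dist z w"
  shows "bounded_lipschitz_on D f"
  using assms unfolding bounded_lipschitz_on_def by blast

lemma bounded_lipschitz_on_const: "bounded_lipschitz_on D (\<lambda>_. c)"
  by (rule bounded_lipschitz_onI[where B = "\<bar>c\<bar>" and L = 0]) auto

lemma bounded_lipschitz_on_add:
  assumes "bounded_lipschitz_on D f" "bounded_lipschitz_on D g"
  shows "bounded_lipschitz_on D (\<lambda>z. f z + g z)"
proof -
  from bounded_lipschitz_onE[OF assms(1)] obtain B L where f: "0 \<le> B" "0 \<le> L" "\<And>z. z \<in> D \<Longrightarrow> \<bar>f z\<bar> \<le> B"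
    "\<And>z w. z \<in> D \<Longrightarrow> w \<in> D \<Longrightarrow> \<bar>f z - f w\<bar> \<le> L * dist z w" by metis
  from bounded_lipschitz_onE[OF assms(2)] obtain B' L' where g: "0 \<le> B'" "0 \<le> L'" "\<And>z. z \<in> D \<Longrightarrow> \<bar>g z\<bar> \<le> B'"
    "\<And>z w. z \<in> D \<Longrightarrow> w \<in> D \<Longrightarrow> \<bar>g z - g w\<bar> \<le> L' * dist z w" by metis
  show ?thesis
  proof (rule bounded_lipschitz_onI)
    show "\<bar>f z + g z\<bar> \<le> B + B'" if "z \<in> D" for z using f(3)[OF that] g(3)[OF that] by linarith
    show "\<bar>f z + g z - (f w + g w)\<bar> \<le> (L + L') * dist z w" if "z \<in> D" "w \<in> D" for z w
      using f(4)[OF that] g(4)[OF that] by (simp add: distrib_right)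
  qed
qed

lemma bounded_lipschitz_on_mult:
  assumes "bounded_lipschitz_on D f" "bounded_lipschitz_on D g"
  shows "bounded_lipschitz_on D (\<lambda>z. f z * g z)"
proof -
  from bounded_lipschitz_onE[OF assms(1)] obtain B L where f: "0 \<le> B" "0 \<le> L" "\<And>z. z \<in> D \<Longrightarrow> \<bar>f z\<bar> \<le> B"
    "\<And>z w. z \<in> D \<Longrightarrow> w \<in> D \<Longrightarrow> \<bar>f z - f w\<bar> \<le> L * dist z w" by metis
  from bounded_lipschitz_onE[OF assms(2)] obtain B' L' where g: "0 \<le> B'" "0 \<le> L'" "\<And>z. z \<in> D \<Longrightarrow> \<bar>g z\<bar> \<le> B'"
    "\<And>z w. z \<in> D \<Longrightarrow> w \<in> D \<Longrightarrow> \<bar>g z - g w\<bar> \<le> L' * dist z w" by metis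
  show ?thesis
  proof (rule bounded_lipschitz_onI)
    show "\<bar>f z * g z\<bar> \<le> B * B'" if "z \<in> D" for z
      unfolding abs_mult using f(1,3) g(1,3) that by (intro mult_mono) auto
    fix z w assume D: "z \<in> D" "w \<in> D"
    have "f z * g z - f w * g w = f z * (g z - g w) + (f z - f w) * g w"
      by (simp add: algebra_simps)
    then have "\<bar>f z * g z - f w * g w\<bar> \<le> \<bar>f z\<bar> * \<bar>g z - g w\<bar> + \<bar>f z - f w\<bar> * \<bar>g w\<bar>"
      by (metis abs_mult abs_triangle_ineq)
    also have "\<dots> \<le> B * (L' * dist z w) + L * dist z w * B'"
      using f g D by (intro add_mono mult_mono) auto
    finally show "\<bar>f z * g z - f w * g w\<bar> \<le> (B * L' + L * B') * dist z w"
      by (simp add: algebra_simps)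
  qed
qed

lemma bounded_lipschitz_on_diff:
  assumes "bounded_lipschitz_on D f" "bounded_lipschitz_on D g"
  shows "bounded_lipschitz_on D (\<lambda>z. f z - g z)"
  using bounded_lipschitz_on_add[OF assms(1) bounded_lipschitz_on_mult[OF bounded_lipschitz_on_const[of D "-1"] assms(2)]]
  by simp

lemma bounded_lipschitz_on_power2:
  "bounded_lipschitz_on D f \<Longrightarrow> bounded_lipschitz_on D (\<lambda>z. (f z)\<^sup>2)"
  unfolding power2_eq_square by (rule bounded_lipschitz_on_mult)

lemma bounded_lipschitz_on_fst: "bounded_lipschitz_on ({0..K} \<times> {0..1}) fst"
  by (rule bounded_lipschitz_onI[where B = K and L = 1])
    (auto simp: dist_real_def[symmetric] intro: dist_fst_le[of "(x, y)" "(x', y')" for x y x' y', simplified])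

lemma bounded_lipschitz_on_snd: "bounded_lipschitz_on ({0..K} \<times> {0..1}) snd"
  by (rule bounded_lipschitz_onI[where B = 1 and L = 1])
    (auto simp: dist_real_def[symmetric] intro: dist_snd_le[of "(x, y)" "(x', y')" for x y x' y', simplified])

lemma bounded_lipschitz_on_compose:
  assumes F: "bounded (F ` C)" "L-lipschitz_on C F"
    and f: "bounded_lipschitz_on D f" and g: "bounded_lipschitz_on D g"
    and maps: "\<And>z. z \<in> D \<Longrightarrow> (f z, g z) \<in> C"
  shows "bounded_lipschitz_on D (\<lambda>z. F (f z, g z))"
proof -
  obtain B where B: "\<And>p. p \<in> C \<Longrightarrow> \<bar>F p\<bar> \<le> B"
    using F(1) unfolding bounded_iff by auto
  from bounded_lipschitz_onE[OF f] obtain Lf where f: "0 \<le> Lf"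
    "\<And>z w. z \<in> D \<Longrightarrow> w \<in> D \<Longrightarrow> \<bar>f z - f w\<bar> \<le> Lf * dist z w" by metis
  from bounded_lipschitz_onE[OF g] obtain Lg where g: "0 \<le> Lg"
    "\<And>z w. z \<in> D \<Longrightarrow> w \<in> D \<Longrightarrow> \<bar>g z - g w\<bar> \<le> Lg * dist z w" by metis
  show ?thesis
  proof (rule bounded_lipschitz_onI)
    show "\<bar>F (f z, g z)\<bar> \<le> B" if "z \<in> D" for z using B maps[OF that] .
    fix z w assume D: "z \<in> D" "w \<in> D"
    have "\<bar>F (f z, g z) - F (f w, g w)\<bar> \<le> L * dist (f z, g z) (f w, g w)"
      using lipschitz_onD[OF F(2) maps[OF D(1)] maps[OF D(2)]] by (simp add: dist_real_def)
    also have "\<dots> \<le> L * (\<bar>f z - f w\<bar> + \<bar>g z - g w\<bar>)"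
      using sqrt_sum_squares_le_sum_abs[of "f z - f w" "g z - g w"] lipschitz_on_nonneg[OF F(2)]
      by (intro mult_left_mono) (auto simp: dist_Pair_Pair dist_real_def)
    also have "\<dots> \<le> L * (Lf * dist z w + Lg * dist z w)"
      using f(2)[OF D] g(2)[OF D] lipschitz_on_nonneg[OF F(2)] by (intro mult_left_mono) auto
    finally show "\<bar>F (f z, g z) - F (f w, g w)\<bar> \<le> (L * (Lf + Lg)) * dist z w"
      by (simp add: algebra_simps)
  qed
qed

lemma reaction_coefficients_bounded_lipschitz:
  assumes "\<forall>F\<in>{F1, F2, G1, G2}. bounded (F ` ({0..} \<times> {0..})) \<and> (\<exists>L. L-lipschitz_on ({0..} \<times> {0..}) F)"
  shows "bounded_lipschitz_on ({0..K} \<times> {0..1}) (\<lambda>z. SigmaR F1 F2 G1 G2 (fst z) (snd z))"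
    and "bounded_lipschitz_on ({0..K} \<times> {0..1}) (\<lambda>z. RR F1 F2 G1 G2 (fst z) (snd z))"
proof -
  note intros = bounded_lipschitz_on_const bounded_lipschitz_on_add bounded_lipschitz_on_mult
    bounded_lipschitz_on_diff bounded_lipschitz_on_fst bounded_lipschitz_on_snd bounded_lipschitz_on_power2
  have F: "bounded_lipschitz_on ({0..K} \<times> {0..1}) (\<lambda>z. F (snd z * fst z, (1 - snd z) * fst z))"
    if "F \<in> {F1, F2, G1, G2}" for F
  proof -
    obtain L where "bounded (F ` ({0..} \<times> {0..}))" "L-lipschitz_on ({0..} \<times> {0..}) F"
      using assms \<open>F \<in> {F1, F2, G1, G2}\<close> by blast
    then show ?thesis
      by (rule bounded_lipschitz_on_compose) (auto intro!: intros)
  qed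
  show "bounded_lipschitz_on ({0..K} \<times> {0..1}) (\<lambda>z. SigmaR F1 F2 G1 G2 (fst z) (snd z))"
    unfolding SigmaR_def Let_def by (intro intros F) auto
  show "bounded_lipschitz_on ({0..K} \<times> {0..1}) (\<lambda>z. RR F1 F2 G1 G2 (fst z) (snd z))"
    unfolding RR_def Let_def by (intro intros F) auto
qed

lemma SigmaR_le:
  assumes "\<forall>F\<in>{F1, F2, G1, G2}. \<forall>p\<in>{0..} \<times> {0..}. \<bar>F p\<bar> \<le> B"
    and "0 \<le> s" "0 \<le> q" "q \<le> 1"
  shows "SigmaR F1 F2 G1 G2 s q \<le> (2 * B) * s"
proof -
  define p where "p = (q * s, (1 - q) * s)"
  have "p \<in> {0..} \<times> {0..}" using assms(2-) by (auto simp: p_def)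
  then have "\<bar>F1 p\<bar> \<le> B" "\<bar>F2 p\<bar> \<le> B" "\<bar>G1 p\<bar> \<le> B" "\<bar>G2 p\<bar> \<le> B"
    using assms(1) by auto
  then have "F1 p + G2 p \<le> 2 * B" "G1 p + F2 p \<le> 2 * B" by auto
  then have "q * (F1 p + G2 p) + (1 - q) * (G1 p + F2 p) \<le> q * (2 * B) + (1 - q) * (2 * B)"
    using assms by (intro add_mono mult_left_mono) auto
  also have "\<dots> = 2 * B" by (simp add: algebra_simps)
  finally show ?thesis
    unfolding SigmaR_def Let_def p_def[symmetric]
    using assms(2) by (simp add: mult.commute mult_left_mono)
qed

lemma reaction_stepD:
  assumes step: "reaction_step F1 F2 G1 G2 \<tau> s0 q0 s1 q1" and "0 \<le> \<tau>"
    and B: "\<forall>F\<in>{F1, F2, G1, G2}. \<forall>p\<in>{0..} \<times> {0..}. \<bar>F p\<bar> \<le> B"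
  shows "0 \<le> s0" "0 \<le> s1" "0 \<le> q1" "q1 \<le> 1" "s1 \<le> s0 * exp (2 * B * \<tau>)"
proof -
  obtain s q where sq: "s 0 = s0" "q 0 = q0" "s \<tau> = s1" "q \<tau> = q1"
    "\<And>t. t \<in> {0..\<tau>} \<Longrightarrow> 0 \<le> s t \<and> 0 \<le> q t \<and> q t \<le> 1 \<and>
      (s has_real_derivative SigmaR F1 F2 G1 G2 (s t) (q t)) (at t within {0..\<tau>})"
    using step unfolding reaction_step_def by blast
  show "0 \<le> s0" "0 \<le> s1" "0 \<le> q1" "q1 \<le> 1"
    using sq(5)[of 0] sq(5)[of \<tau>] sq(1-4) \<open>0 \<le> \<tau>\<close> by auto
  have "s \<tau> \<le> s 0 * exp (2 * B * \<tau>)"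
  proof (rule gronwall_exp_bound)
    show "(s has_real_derivative SigmaR F1 F2 G1 G2 (s t) (q t)) (at t within {0..\<tau>})"
      if "t \<in> {0..\<tau>}" for t using sq(5)[OF that] by blast
    show "SigmaR F1 F2 G1 G2 (s t) (q t) \<le> 2 * B * s t" if "t \<in> {0..\<tau>}" for t
      by (rule SigmaR_le[OF B]) (use sq(5)[OF that] in auto)
  qed (use \<open>0 \<le> \<tau>\<close> in auto)
  then show "s1 \<le> s0 * exp (2 * B * \<tau>)" using sq by simp
qed

lemma reaction_step_lipschitz:
  assumes F: "\<forall>F\<in>{F1, F2, G1, G2}. bounded (F ` ({0..} \<times> {0..})) \<and> (\<exists>L. L-lipschitz_on ({0..} \<times> {0..}) F)"
    and B: "\<forall>F\<in>{F1, F2, G1, G2}. \<forall>p\<in>{0..} \<times> {0..}. \<bar>F p\<bar> \<le> B"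
    and "0 \<le> B" "0 \<le> \<tau>"
  obtains L where "0 \<le> L"
    "\<And>s0 q0 s1 q1 s0' q0' s1' q1'. s0 \<le> K \<Longrightarrow> s0' \<le> K \<Longrightarrow>
      reaction_step F1 F2 G1 G2 \<tau> s0 q0 s1 q1 \<Longrightarrow> reaction_step F1 F2 G1 G2 \<tau> s0' q0' s1' q1' \<Longrightarrow>
      dist (s1, q1) (s1', q1') \<le> L * dist (s0, q0) (s0', q0')"
proof -
  let ?S = "SigmaR F1 F2 G1 G2" and ?R = "RR F1 F2 G1 G2"
  define D where "D = {0..K * exp (2 * B * \<tau>)} \<times> {0..1::real}"
  from bounded_lipschitz_onE[OF reaction_coefficients_bounded_lipschitz(1)[OF F, of "K * exp (2 * B * \<tau>)"]]
  obtain LS where LS: "0 \<le> LS" "\<And>z w. z \<in> D \<Longrightarrow> w \<in> D \<Longrightarrow>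
      \<bar>?S (fst z) (snd z) - ?S (fst w) (snd w)\<bar> \<le> LS * dist z w"
    unfolding D_def by metis
  from bounded_lipschitz_onE[OF reaction_coefficients_bounded_lipschitz(2)[OF F, of "K * exp (2 * B * \<tau>)"]]
  obtain LR where LR: "0 \<le> LR" "\<And>z w. z \<in> D \<Longrightarrow> w \<in> D \<Longrightarrow>
      \<bar>?R (fst z) (snd z) - ?R (fst w) (snd w)\<bar> \<le> LR * dist z w"
    unfolding D_def by metis
  define C where "C = 2 * (LS + LR)"
  show thesis
  proof (rule that[of "sqrt (exp (C * \<tau>))"])
    show "0 \<le> sqrt (exp (C * \<tau>))" by simp
    fix s0 q0 s1 q1 s0' q0' s1' q1'
    assume K: "s0 \<le> K" "s0' \<le> K"
      and step: "reaction_step F1 F2 G1 G2 \<tau> s0 q0 s1 q1" "reaction_step F1 F2 G1 G2 \<tau> s0' q0' s1' q1'"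
    have sol: "\<exists>s q. s 0 = s0 \<and> q 0 = q0 \<and> s \<tau> = s1 \<and> q \<tau> = q1 \<and> (\<forall>t\<in>{0..\<tau>}. (s t, q t) \<in> D \<and>
           (s has_real_derivative ?S (s t) (q t)) (at t within {0..\<tau>}) \<and>
           (q has_real_derivative ?R (s t) (q t)) (at t within {0..\<tau>}))"
      if "s0 \<le> K" and step: "reaction_step F1 F2 G1 G2 \<tau> s0 q0 s1 q1" for s0 q0 s1 q1
    proof -
      obtain s q where sq: "s 0 = s0" "q 0 = q0" "s \<tau> = s1" "q \<tau> = q1"
        "\<And>t. t \<in> {0..\<tau>} \<Longrightarrow> 0 \<le> s t \<and> 0 \<le> q t \<and> q t \<le> 1 \<and>
          (s has_real_derivative ?S (s t) (q t)) (at t within {0..\<tau>}) \<and>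
          (q has_real_derivative ?R (s t) (q t)) (at t within {0..\<tau>})"
        using step unfolding reaction_step_def by blast
      have "s t \<le> K * exp (2 * B * \<tau>)" if t: "t \<in> {0..\<tau>}" for t
      proof -
        have "s t \<le> s 0 * exp (2 * B * t)"
        proof (rule gronwall_exp_bound)
          show "(s has_real_derivative ?S (s t) (q t)) (at t within {0..\<tau>})"
            if "t \<in> {0..\<tau>}" for t using sq(5)[OF that] by blast
          show "?S (s t) (q t) \<le> 2 * B * s t" if "t \<in> {0..\<tau>}" for t
            by (rule SigmaR_le[OF B]) (use sq(5)[OF that] in auto)
        qed (use t in auto)
        also have "\<dots> \<le> K * exp (2 * B * \<tau>)"
          using sq(5)[of 0] sq(1) \<open>s0 \<le> K\<close> t \<open>0 \<le> B\<close> by (intro mult_mono) (auto intro: mult_left_mono)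
        finally show ?thesis .
      qed
      then show ?thesis using sq unfolding D_def
        by (intro exI[of _ s] exI[of _ q]) auto
    qed
    obtain s q where sq: "s 0 = s0" "q 0 = q0" "s \<tau> = s1" "q \<tau> = q1"
      "\<And>t. t \<in> {0..\<tau>} \<Longrightarrow> (s t, q t) \<in> D \<and>
           (s has_real_derivative ?S (s t) (q t)) (at t within {0..\<tau>}) \<and>
           (q has_real_derivative ?R (s t) (q t)) (at t within {0..\<tau>})"
      using sol[OF K(1) step(1)] by blast
    obtain s' q' where sq': "s' 0 = s0'" "q' 0 = q0'" "s' \<tau> = s1'" "q' \<tau> = q1'"
      "\<And>t. t \<in> {0..\<tau>} \<Longrightarrow> (s' t, q' t) \<in> D \<and>
           (s' has_real_derivative ?S (s' t) (q' t)) (at t within {0..\<tau>}) \<and>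
           (q' has_real_derivative ?R (s' t) (q' t)) (at t within {0..\<tau>})"
      using sol[OF K(2) step(2)] by blast
    define u where "u t = (s t - s' t)\<^sup>2 + (q t - q' t)\<^sup>2" for t
    define d where "d t = dist (s t, q t) (s' t, q' t)" for t
    have du: "d t = sqrt (u t)" for t
      by (simp add: d_def u_def dist_Pair_Pair dist_real_def)
    have d2: "d t * d t = u t" for t
      unfolding du by (simp add: u_def)
    have "u \<tau> \<le> u 0 * exp (C * \<tau>)"
    proof (rule gronwall_exp_bound)
      fix t assume t: "t \<in> {0..\<tau>}"
      let ?u' = "2 * (s t - s' t) * (?S (s t) (q t) - ?S (s' t) (q' t)) + 2 * (q t - q' t) * (?R (s t) (q t) - ?R (s' t) (q' t))"
      show "(u has_real_derivative ?u') (at t within {0..\<tau>})"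
        unfolding u_def using sq(5)[OF t] sq'(5)[OF t]
        by (auto intro!: derivative_eq_intros simp: algebra_simps)
      have S: "\<bar>?S (s t) (q t) - ?S (s' t) (q' t)\<bar> \<le> LS * d t"
        using LS(2)[of "(s t, q t)" "(s' t, q' t)"] sq(5)[OF t] sq'(5)[OF t] by (simp add: d_def)
      have R: "\<bar>?R (s t) (q t) - ?R (s' t) (q' t)\<bar> \<le> LR * d t"
        using LR(2)[of "(s t, q t)" "(s' t, q' t)"] sq(5)[OF t] sq'(5)[OF t] by (simp add: d_def)
      have sd: "\<bar>s t - s' t\<bar> \<le> d t" and qd: "\<bar>q t - q' t\<bar> \<le> d t"
        unfolding du u_def by (auto intro!: real_le_rsqrt)
      have d0: "0 \<le> d t" by (simp add: d_def)
      have "(s t - s' t) * (?S (s t) (q t) - ?S (s' t) (q' t)) \<le> \<bar>s t - s' t\<bar> * \<bar>?S (s t) (q t) - ?S (s' t) (q' t)\<bar>"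
        by (metis abs_ge_self abs_mult)
      also have "\<dots> \<le> d t * (LS * d t)" using S sd d0 by (intro mult_mono) auto
      finally have 1: "(s t - s' t) * (?S (s t) (q t) - ?S (s' t) (q' t)) \<le> LS * u t"
        by (simp add: d2[symmetric] ac_simps)
      have "(q t - q' t) * (?R (s t) (q t) - ?R (s' t) (q' t)) \<le> \<bar>q t - q' t\<bar> * \<bar>?R (s t) (q t) - ?R (s' t) (q' t)\<bar>"
        by (metis abs_ge_self abs_mult)
      also have "\<dots> \<le> d t * (LR * d t)" using R qd d0 by (intro mult_mono) auto
      finally have 2: "(q t - q' t) * (?R (s t) (q t) - ?R (s' t) (q' t)) \<le> LR * u t"
        by (simp add: d2[symmetric] ac_simps)
      show "?u' \<le> C * u t"
        using 1 2 by (simp add: C_def algebra_simps)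
    qed (use \<open>0 \<le> \<tau>\<close> in auto)
    then have "d \<tau> \<le> sqrt (u 0 * exp (C * \<tau>))" unfolding du by simp
    also have "\<dots> = sqrt (exp (C * \<tau>)) * d 0" unfolding du by (simp add: real_sqrt_mult)
    finally show "dist (s1, q1) (s1', q1') \<le> sqrt (exp (C * \<tau>)) * dist (s0, q0) (s0', q0')"
      by (simp add: d_def sq sq')
  qed
qed

lemma reaction_step_measurable:
  assumes F: "\<forall>F\<in>{F1, F2, G1, G2}. bounded (F ` ({0..} \<times> {0..})) \<and> (\<exists>L. L-lipschitz_on ({0..} \<times> {0..}) F)"
    and B: "\<forall>F\<in>{F1, F2, G1, G2}. \<forall>p\<in>{0..} \<times> {0..}. \<bar>F p\<bar> \<le> B"
    and "0 \<le> B" "0 \<le> \<tau>"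
    and [measurable]: "sg \<in> borel_measurable N" "r \<in> borel_measurable N"
    and step: "\<And>x. x \<in> space N \<Longrightarrow> reaction_step F1 F2 G1 G2 \<tau> (sg x) (r x) (sh x) (rh x)"
  shows "sh \<in> borel_measurable N" "rh \<in> borel_measurable N"
proof -
  define D where "D = (\<lambda>x. (sg x, r x)) ` space N"
  define pre where "pre z = (SOME x. x \<in> space N \<and> z = (sg x, r x))" for z
  define \<Phi> where "\<Phi> z = (sh (pre z), rh (pre z))" for z
  have pre: "pre z \<in> space N" "(sg (pre z), r (pre z)) = z" if "z \<in> D" for z
  proof -
    have "\<exists>x. x \<in> space N \<and> z = (sg x, r x)" using that by (auto simp: D_def)
    from someI_ex[OF this] show "pre z \<in> space N" "(sg (pre z), r (pre z)) = z"
      by (auto simp: pre_def)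
  qed
  have step\<Phi>: "reaction_step F1 F2 G1 G2 \<tau> (fst z) (snd z) (fst (\<Phi> z)) (snd (\<Phi> z))" if "z \<in> D" for z
    using step[OF pre(1)[OF that]] pre(2)[OF that] by (auto simp: \<Phi>_def prod_eq_iff)
  have \<Phi>: "\<Phi> (sg x, r x) = (sh x, rh x)" if x: "x \<in> space N" for x
  proof -
    have "(sg x, r x) \<in> D" using x by (auto simp: D_def)
    from reaction_step_lipschitz[OF F B \<open>0 \<le> B\<close> \<open>0 \<le> \<tau>\<close>, of "sg x"] step\<Phi>[OF this] step[OF x]
    have "dist (\<Phi> (sg x, r x)) (sh x, rh x) \<le> 0"
      by (metis dist_self mult_zero_right order_refl prod.collapse fst_conv snd_conv)
    then show ?thesis by simp
  qed
  have "continuous_on D \<Phi>"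
    unfolding continuous_on_iff
  proof (intro ballI allI impI)
    fix z and e :: real assume z: "z \<in> D" and e: "0 < e"
    from reaction_step_lipschitz[OF F B \<open>0 \<le> B\<close> \<open>0 \<le> \<tau>\<close>, of "fst z + 1"]
    obtain L where L: "0 \<le> L" "\<And>s0 q0 s1 q1 s0' q0' s1' q1'. s0 \<le> fst z + 1 \<Longrightarrow> s0' \<le> fst z + 1 \<Longrightarrow>
      reaction_step F1 F2 G1 G2 \<tau> s0 q0 s1 q1 \<Longrightarrow> reaction_step F1 F2 G1 G2 \<tau> s0' q0' s1' q1' \<Longrightarrow>
      dist (s1, q1) (s1', q1') \<le> L * dist (s0, q0) (s0', q0')" by blast
    define d where "d = min 1 (e / (L + 1))"
    have "0 < d" using e L(1) by (simp add: d_def)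
    moreover have "dist (\<Phi> w) (\<Phi> z) < e" if w: "w \<in> D" and wz: "dist w z < d" for w
    proof -
      have "\<bar>fst w - fst z\<bar> \<le> dist w z" using dist_fst_le[of w z] by (simp add: dist_real_def)
      then have "fst w \<le> fst z + 1" using wz unfolding d_def by linarith
      from L(2)[OF this _ step\<Phi>[OF w] step\<Phi>[OF z]]
      have "dist (\<Phi> w) (\<Phi> z) \<le> L * dist w z" by simp
      also have "\<dots> \<le> (L + 1) * dist w z" by (simp add: distrib_right)
      also have "\<dots> < (L + 1) * (e / (L + 1))" using wz L(1) by (intro mult_strict_left_mono) (auto simp: d_def)
      also have "\<dots> = e" using L(1) by simp
      finally show ?thesis .
    qed
    ultimately show "\<exists>d>0. \<forall>w\<in>D. dist w z < d \<longrightarrow> dist (\<Phi> w) (\<Phi> z) < e" by blast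
  qed
  then have "\<Phi> \<in> borel_measurable (restrict_space borel D)"
    by (rule borel_measurable_continuous_on_restrict)
  moreover have "(\<lambda>x. (sg x, r x)) \<in> measurable N (restrict_space borel D)"
    by (intro measurable_restrict_space2) (auto simp: D_def)
  ultimately have "(\<lambda>x. \<Phi> (sg x, r x)) \<in> borel_measurable N"
    by (rule measurable_compose[rotated])
  then have "(\<lambda>x. (sh x, rh x)) \<in> borel_measurable N"
    by (rule measurable_cong[THEN iffD1, rotated]) (rule \<Phi>)
  then have *: "(\<lambda>x. fst (sh x, rh x)) \<in> borel_measurable N" "(\<lambda>x. snd (sh x, rh x)) \<in> borel_measurable N"
    by (rule borel_measurable_continuous_on[where f = fst, rotated] borel_measurable_continuous_on[where f = snd, rotated];
        simp add: continuous_on_fst continuous_on_snd)+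
  show "sh \<in> borel_measurable N" "rh \<in> borel_measurable N" using * by simp_all
qed

section \<open>Couplings and back-transport of mass\<close>

lemma ex_two_branch_measure:
  assumes [measurable]: "w \<in> borel_measurable N" "v \<in> borel_measurable N" "f \<in> measurable N M" "g \<in> measurable N M"
  shows "\<exists>N'. sets N' = sets M \<and> (\<forall>h\<in>borel_measurable M.
    (\<integral>\<^sup>+ x. h x \<partial>N') = (\<integral>\<^sup>+ z. w z * h (f z) + v z * h (g z) \<partial>N))"
proof -
  interpret c: sigma_finite_measure "count_space (UNIV :: bool set)"
    by (rule sigma_finite_measure_count_space_finite) simp
  define P where "P = N \<Otimes>\<^sub>M count_space (UNIV :: bool set)"
  define W where "W = (\<lambda>(z, c). if c then w z else v z)"
  define m where "m = (\<lambda>(z, c). if c then f z else g z)"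
  have [measurable]: "W \<in> borel_measurable P" "m \<in> measurable P M"
    unfolding W_def m_def P_def by measurable
  define N' where "N' = distr (density P W) M m"
  have "(\<integral>\<^sup>+ x. h x \<partial>N') = (\<integral>\<^sup>+ z. w z * h (f z) + v z * h (g z) \<partial>N)"
    if [measurable]: "h \<in> borel_measurable M" for h
  proof -
    have "(\<integral>\<^sup>+ x. h x \<partial>N') = (\<integral>\<^sup>+ y. W y * h (m y) \<partial>P)"
      unfolding N'_def by (simp add: nn_integral_distr nn_integral_density)
    also have "\<dots> = (\<integral>\<^sup>+ z. \<integral>\<^sup>+ c. W (z, c) * h (m (z, c)) \<partial>count_space UNIV \<partial>N)"
      unfolding P_def by (rule c.nn_integral_fst[symmetric]) (simp add: P_def[symmetric])
    also have "\<dots> = (\<integral>\<^sup>+ z. w z * h (f z) + v z * h (g z) \<partial>N)"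
      by (intro nn_integral_cong) (simp add: nn_integral_count_space_finite UNIV_bool W_def m_def add.commute)
    finally show ?thesis .
  qed
  moreover have "sets N' = sets M" by (simp add: N'_def)
  ultimately show ?thesis by blast
qed

lemma dominated_measure_density:
  assumes "finite_measure M" and sets: "sets N = sets M"
    and le: "\<And>A. A \<in> sets M \<Longrightarrow> emeasure N A \<le> emeasure M A"
  shows "\<exists>f\<in>borel_measurable M. (\<forall>x. 0 \<le> f x \<and> f x \<le> (1::real)) \<and> N = density M (\<lambda>x. ennreal (f x))"
proof -
  interpret finite_measure M by fact
  have "absolutely_continuous M N"
    unfolding absolutely_continuous_def
  proof
    fix A assume "A \<in> null_sets M"
    then have "A \<in> sets M" "emeasure M A = 0" by auto
    then show "A \<in> null_sets N" using le[of A] sets by (auto intro!: null_setsI)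
  qed
  from Radon_Nikodym[OF this sets] obtain f where [measurable]: "f \<in> borel_measurable M" and f: "density M f = N"
    by auto
  define A where "A = {x\<in>space M. 1 < f x}"
  have [measurable]: "A \<in> sets M" unfolding A_def by measurable
  have "(\<integral>\<^sup>+ x. (f x - 1) * indicator A x \<partial>M) + emeasure M A
      = (\<integral>\<^sup>+ x. (f x - 1) * indicator A x + indicator A x \<partial>M)"
    by (subst nn_integral_add) auto
  also have "\<dots> = (\<integral>\<^sup>+ x. f x * indicator A x \<partial>M)"
    by (intro nn_integral_cong) (auto simp: A_def indicator_def diff_add_cancel_ennreal less_imp_le)
  also have "\<dots> = emeasure N A" unfolding f[symmetric] by (rule emeasure_density[symmetric]) auto
  also have "\<dots> \<le> emeasure M A" by (rule le) auto
  finally have "(\<integral>\<^sup>+ x. (f x - 1) * indicator A x \<partial>M) = 0"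
    using emeasure_finite[of A]
    by (metis add.commute add_0 ennreal_add_left_cancel_le infinity_ennreal_def le_zero_eq add.right_neutral)
  then have "AE x in M. (f x - 1) * indicator A x = 0"
    by (subst (asm) nn_integral_0_iff_AE) auto
  then have "AE x in M. f x \<le> 1"
    using AE_space
  proof eventually_elim
    case (elim x)
    show ?case
    proof (rule ccontr)
      assume "\<not> f x \<le> 1"
      then have "f x - 1 = 0" "1 < f x" using elim by (auto simp: A_def)
      then show False by (meson ennreal_minus_eq_0 leD)
    qed
  qed
  then have "AE x in M. f x = ennreal (enn2real (min 1 (f x)))"
  proof eventually_elim
    case (elim x)
    then have "f x < top" using le_less_trans[OF elim] by simp
    then show ?case using elim by (simp add: min_absorb2)
  qed
  then have "density M f = density M (\<lambda>x. ennreal (enn2real (min 1 (f x))))"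
    by (intro density_cong) auto
  moreover have "enn2real (min 1 (f x)) \<le> 1" for x
    using enn2real_mono[of "min 1 (f x)" 1] by simp
  ultimately show ?thesis
    using f by (intro bexI[of _ "\<lambda>x. enn2real (min 1 (f x))"]) auto
qed

lemma emeasure_distr_nn_integral:
  assumes "\<pi> \<in> measurable M N" "A \<in> sets N"
  shows "emeasure (distr M N \<pi>) A = (\<integral>\<^sup>+ z. indicator A (\<pi> z) \<partial>M)"
  using assms nn_integral_distr[OF assms(1), of "indicator A"]
    nn_integral_indicator[of A "distr M N \<pi>"] by simp

lemma emeasure_dmeas:
  assumes "f \<in> borel_measurable borel" "A \<in> sets borel"
  shows "emeasure (dmeas a b f) A = (\<integral>\<^sup>+ x. ennreal (indicator {a<..<b} x * f x) * indicator A x \<partial>lborel)"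
  unfolding dmeas_def using assms by (subst emeasure_density) auto

lemma sets_dmeas [simp, measurable_cong]: "sets (dmeas a b f) = sets borel"
  by (simp add: dmeas_def)

lemma space_dmeas [simp]: "space (dmeas a b f) = UNIV"
  by (simp add: dmeas_def)

lemma dmeas_cong:
  assumes "\<And>x. x \<in> {a<..<b} \<Longrightarrow> f x = g x"
  shows "dmeas a b f = dmeas a b g"
proof -
  have "indicator {a<..<b} x * f x = indicator {a<..<b} x * g x" for x
    using assms[of x] by (auto simp: indicator_def)
  then show ?thesis unfolding dmeas_def by (simp only:)
qed

lemma emeasure_dmeas_eq_integral:
  assumes "f \<in> borel_measurable borel" "\<And>x. x \<in> {a<..<b} \<Longrightarrow> 0 \<le> f x"
    "set_integrable lborel {a<..<b} f" "A \<in> sets borel"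
  shows "emeasure (dmeas a b f) A = ennreal (\<integral>x\<in>{a<..<b}. indicator A x * f x \<partial>lborel)"
proof -
  have "integrable lborel (\<lambda>x. indicator A x *\<^sub>R (indicator {a<..<b} x *\<^sub>R f x))"
    using assms(3,4) unfolding set_integrable_def by (intro integrable_mult_indicator[where f = "\<lambda>x. indicator {a<..<b} x *\<^sub>R f x"]) auto
  then have i: "integrable lborel (\<lambda>x. indicator {a<..<b} x *\<^sub>R (indicator A x * f x))"
    by (simp add: ac_simps)
  show ?thesis
    unfolding emeasure_dmeas[OF assms(1,4)] set_lebesgue_integral_def
    by (subst nn_integral_eq_integral[OF i, symmetric])
      (use assms(2) in \<open>auto intro!: nn_integral_cong simp: indicator_def split: if_splits\<close>)
qed

lemma finite_measure_dmeas:
  assumes "f \<in> borel_measurable borel" "\<And>x. x \<in> {a<..<b} \<Longrightarrow> 0 \<le> f x"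
    "set_integrable lborel {a<..<b} f"
  shows "finite_measure (dmeas a b f)"
  using emeasure_dmeas_eq_integral[OF assms, of UNIV] by (intro finite_measureI) auto

lemma coupling_marginal_density:
  assumes \<rho>: "\<rho> \<in> borel_measurable borel" "\<And>x. x \<in> {a<..<b} \<Longrightarrow> 0 \<le> \<rho> x" "set_integrable lborel {a<..<b} \<rho>"
    and \<pi> [measurable]: "\<pi> \<in> borel_measurable \<gamma>" and marg: "distr \<gamma> borel \<pi> = dmeas a b \<rho>"
    and [measurable]: "G \<in> sets \<gamma>" "E \<in> sets borel" and GE: "\<And>z. z \<in> G \<Longrightarrow> \<pi> z \<in> E"
  shows "\<exists>\<alpha>\<in>borel_measurable borel. (\<forall>x\<in>{a<..<b}. 0 \<le> \<alpha> x \<and> \<alpha> x \<le> \<rho> x) \<and> (\<forall>x. x \<notin> E \<longrightarrow> \<alpha> x = 0) \<and>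
    (\<forall>A\<in>sets borel. (\<integral>\<^sup>+ z. indicator G z * indicator A (\<pi> z) \<partial>\<gamma>) = emeasure (dmeas a b \<alpha>) A)"
proof -
  note [measurable] = \<rho>(1)
  interpret finite_measure "dmeas a b \<rho>" by (rule finite_measure_dmeas[OF \<rho>])
  define N where "N = distr (density \<gamma> (indicator G)) borel \<pi>"
  have N: "emeasure N A = (\<integral>\<^sup>+ z. indicator G z * indicator A (\<pi> z) \<partial>\<gamma>)" if [measurable]: "A \<in> sets borel" for A
  proof -
    have "emeasure N A = (\<integral>\<^sup>+ x. indicator A x \<partial>N)" by (simp add: N_def)
    also have "\<dots> = (\<integral>\<^sup>+ z. indicator G z * indicator A (\<pi> z) \<partial>\<gamma>)"
      unfolding N_def by (subst nn_integral_distr) (auto simp: nn_integral_density)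
    finally show ?thesis .
  qed
  have "emeasure N A \<le> emeasure (dmeas a b \<rho>) A" if "A \<in> sets (dmeas a b \<rho>)" for A
  proof -
    have A [measurable]: "A \<in> sets borel" using that by simp
    have "emeasure (dmeas a b \<rho>) A = (\<integral>\<^sup>+ z. indicator A (\<pi> z) \<partial>\<gamma>)"
      unfolding marg[symmetric] by (rule emeasure_distr_nn_integral) auto
    then show ?thesis
      unfolding N[OF A] by (auto intro!: nn_integral_mono simp: indicator_def)
  qed
  moreover have "sets N = sets (dmeas a b \<rho>)" by (simp add: N_def)
  ultimately obtain f where f [measurable]: "f \<in> borel_measurable borel" and f01: "\<And>x. 0 \<le> f x \<and> f x \<le> 1"
    and Nf: "N = density (dmeas a b \<rho>) (\<lambda>x. ennreal (f x))"
    using dominated_measure_density[OF finite_measure_axioms, of N]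
      measurable_cong_sets[OF sets_dmeas refl, of a b \<rho> "borel :: real measure"] by blast
  define \<alpha> where "\<alpha> x = indicator E x * (f x * \<rho> x)" for x
  have [measurable]: "\<alpha> \<in> borel_measurable borel" unfolding \<alpha>_def by measurable
  show ?thesis
  proof (intro bexI[of _ \<alpha>] conjI ballI allI impI)
    show "0 \<le> \<alpha> x" "\<alpha> x \<le> \<rho> x" if "x \<in> {a<..<b}" for x
      using \<rho>(2)[OF that] f01[of x] by (auto simp: \<alpha>_def indicator_def mult_left_le_one_le)
    show "\<alpha> x = 0" if "x \<notin> E" for x using that by (simp add: \<alpha>_def)
    fix A :: "real set" assume [measurable]: "A \<in> sets borel"
    have "(\<integral>\<^sup>+ z. indicator G z * indicator A (\<pi> z) \<partial>\<gamma>) = (\<integral>\<^sup>+ z. indicator G z * indicator (A \<inter> E) (\<pi> z) \<partial>\<gamma>)"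
      using GE by (auto intro!: nn_integral_cong simp: indicator_def)
    also have "\<dots> = emeasure N (A \<inter> E)" by (rule N[symmetric]) auto
    also have "\<dots> = (\<integral>\<^sup>+ x. ennreal (f x) * indicator (A \<inter> E) x \<partial>dmeas a b \<rho>)"
      unfolding Nf by (rule emeasure_density) auto
    also have "\<dots> = (\<integral>\<^sup>+ x. ennreal (indicator {a<..<b} x * \<rho> x) * (ennreal (f x) * indicator (A \<inter> E) x) \<partial>lborel)"
      unfolding dmeas_def by (subst nn_integral_density) auto
    also have "\<dots> = emeasure (dmeas a b \<alpha>) A"
      using f01 \<rho>(2) by (subst emeasure_dmeas)
        (auto intro!: nn_integral_cong simp: \<alpha>_def indicator_def ennreal_mult[symmetric] mult.commute)
    finally show "(\<integral>\<^sup>+ z. indicator G z * indicator A (\<pi> z) \<partial>\<gamma>) = emeasure (dmeas a b \<alpha>) A" .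
  qed simp
qed

lemma W2sq_le: "\<gamma> \<in> couplings \<mu> \<nu> \<Longrightarrow> W2sq \<mu> \<nu> \<le> (\<integral>\<^sup>+ z. ennreal ((fst z - snd z)^2) \<partial>\<gamma>)"
  unfolding W2sq_def by (rule INF_lower)

lemma measurable_fst_snd_borel:
  fixes \<gamma> :: "(real \<times> real) measure"
  assumes "sets \<gamma> = sets borel"
  shows "fst \<in> borel_measurable \<gamma>" "snd \<in> borel_measurable \<gamma>"
  using assms by (auto simp: measurable_cong_sets[OF assms refl] borel_prod[symmetric])

lemma coupling_back_transport:
  assumes \<rho>: "\<rho> \<in> borel_measurable borel" "\<And>x. x \<in> {a<..<b} \<Longrightarrow> 0 \<le> \<rho> x" "set_integrable lborel {a<..<b} \<rho>"
    and \<rho>h: "\<rho>h \<in> borel_measurable borel" "\<And>x. x \<in> {a<..<b} \<Longrightarrow> 0 \<le> \<rho>h x" "set_integrable lborel {a<..<b} \<rho>h"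
    and \<gamma>: "\<gamma> \<in> couplings (dmeas a b \<rho>) (dmeas a b \<rho>h)"
    and [measurable]: "E \<in> sets borel" "Q \<in> sets borel" and \<epsilon>: "0 \<le> \<epsilon>" "\<epsilon> \<le> 1"
  obtains \<alpha> \<beta> where
    "\<alpha> \<in> borel_measurable borel" "\<And>x. x \<in> {a<..<b} \<Longrightarrow> 0 \<le> \<alpha> x \<and> \<alpha> x \<le> \<rho> x" "\<And>x. x \<notin> E \<Longrightarrow> \<alpha> x = 0"
    "\<beta> \<in> borel_measurable borel" "\<And>x. x \<in> {a<..<b} \<Longrightarrow> 0 \<le> \<beta> x \<and> \<beta> x \<le> \<rho>h x" "\<And>x. x \<notin> Q \<Longrightarrow> \<beta> x = 0"
    "emeasure (dmeas a b \<alpha>) UNIV = emeasure \<gamma> (E \<times> Q)" "emeasure (dmeas a b \<beta>) UNIV = emeasure \<gamma> (E \<times> Q)"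
    "W2sq (dmeas a b (\<lambda>x. \<rho> x - \<epsilon> * \<alpha> x + \<epsilon> * \<beta> x)) (dmeas a b \<rho>h) \<le> (\<integral>\<^sup>+ z. ennreal ((fst z - snd z)^2) \<partial>\<gamma>)"
proof -
  note [measurable] = \<rho>(1) \<rho>h(1)
  have sets\<gamma> [measurable_cong]: "sets \<gamma> = sets borel" and marg: "distr \<gamma> borel fst = dmeas a b \<rho>" "distr \<gamma> borel snd = dmeas a b \<rho>h"
    using \<gamma> by (auto simp: couplings_def)
  note [measurable] = measurable_fst_snd_borel[OF sets\<gamma>]
  have fs [measurable]: "fst \<in> borel_measurable (borel :: (real \<times> real) measure)"
    "snd \<in> borel_measurable (borel :: (real \<times> real) measure)"
    by (rule measurable_fst_snd_borel; simp)+
  define G where "G = E \<times> Q"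
  have G [measurable]: "G \<in> sets \<gamma>" unfolding G_def sets\<gamma> by (intro borel_Times) auto
  have GE: "fst z \<in> E" "snd z \<in> Q" if "z \<in> G" for z using that by (auto simp: G_def)
  from coupling_marginal_density[OF \<rho> measurable_fst_snd_borel(1)[OF sets\<gamma>] marg(1) G \<open>E \<in> sets borel\<close> GE(1)]
  obtain \<alpha> where \<alpha>: "\<alpha> \<in> borel_measurable borel" "\<And>x. x \<in> {a<..<b} \<Longrightarrow> 0 \<le> \<alpha> x \<and> \<alpha> x \<le> \<rho> x"
    "\<And>x. x \<notin> E \<Longrightarrow> \<alpha> x = 0"
    "\<And>A. A \<in> sets borel \<Longrightarrow> (\<integral>\<^sup>+ z. indicator G z * indicator A (fst z) \<partial>\<gamma>) = emeasure (dmeas a b \<alpha>) A"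
    by blast
  from coupling_marginal_density[OF \<rho>h measurable_fst_snd_borel(2)[OF sets\<gamma>] marg(2) G \<open>Q \<in> sets borel\<close> GE(2)]
  obtain \<beta> where \<beta>: "\<beta> \<in> borel_measurable borel" "\<And>x. x \<in> {a<..<b} \<Longrightarrow> 0 \<le> \<beta> x \<and> \<beta> x \<le> \<rho>h x"
    "\<And>x. x \<notin> Q \<Longrightarrow> \<beta> x = 0"
    "\<And>A. A \<in> sets borel \<Longrightarrow> (\<integral>\<^sup>+ z. indicator G z * indicator A (snd z) \<partial>\<gamma>) = emeasure (dmeas a b \<beta>) A"
    by blast
  note [measurable] = \<alpha>(1) \<beta>(1)
  define w where "w z = ennreal (1 - \<epsilon> * indicator G z)" for z
  define v where "v z = ennreal (\<epsilon> * indicator G z)" for z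
  have [measurable]: "w \<in> borel_measurable \<gamma>" "v \<in> borel_measurable \<gamma>" unfolding w_def v_def by measurable
  have id: "(\<lambda>z. z) \<in> measurable \<gamma> borel" and dg: "(\<lambda>z. (snd z, snd z)) \<in> measurable \<gamma> borel" by measurable
  have wv: "w z + v z = 1" for z
    unfolding w_def v_def using \<epsilon> by (subst ennreal_plus[symmetric]) (auto simp: indicator_def)
  from ex_two_branch_measure[OF \<open>w \<in> _\<close> \<open>v \<in> _\<close> id dg] obtain \<gamma>' where
    sets\<gamma>' [measurable_cong]: "sets \<gamma>' = sets borel" and
    \<gamma>': "\<And>h. h \<in> borel_measurable borel \<Longrightarrow> (\<integral>\<^sup>+ x. h x \<partial>\<gamma>') = (\<integral>\<^sup>+ z. w z * h z + v z * h (snd z, snd z) \<partial>\<gamma>)"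
    by blast
  note [measurable] = measurable_fst_snd_borel[OF sets\<gamma>']
  let ?\<rho>' = "\<lambda>x. \<rho> x - \<epsilon> * \<alpha> x + \<epsilon> * \<beta> x"
  have marg': "emeasure (distr \<gamma>' borel \<pi>) A = (\<integral>\<^sup>+ z. w z * indicator A (\<pi> z) + v z * indicator A (\<pi> (snd z, snd z)) \<partial>\<gamma>)"
    if [measurable]: "A \<in> sets borel" "\<pi> \<in> borel_measurable borel" for A and \<pi> :: "real \<times> real \<Rightarrow> real"
  proof -
    have "\<pi> \<in> borel_measurable \<gamma>'" by measurable
    then have "emeasure (distr \<gamma>' borel \<pi>) A = (\<integral>\<^sup>+ z. indicator A (\<pi> z) \<partial>\<gamma>')"
      by (rule emeasure_distr_nn_integral) auto
    then show ?thesis by (simp add: \<gamma>')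
  qed
  have snd': "distr \<gamma>' borel snd = dmeas a b \<rho>h"
  proof (rule measure_eqI)
    fix A assume "A \<in> sets (distr \<gamma>' borel snd)"
    then have A [measurable]: "A \<in> sets borel" by simp
    have "emeasure (distr \<gamma>' borel snd) A = (\<integral>\<^sup>+ z. indicator A (snd z) \<partial>\<gamma>)"
      by (subst marg') (auto simp: distrib_right[symmetric] wv)
    also have "\<dots> = emeasure (distr \<gamma> borel snd) A"
      by (rule emeasure_distr_nn_integral[symmetric]) auto
    finally show "emeasure (distr \<gamma>' borel snd) A = emeasure (dmeas a b \<rho>h) A" by (simp add: marg)
  qed simp
  have fst': "distr \<gamma>' borel fst = dmeas a b ?\<rho>'"
  proof (rule measure_eqI)
    fix A assume "A \<in> sets (distr \<gamma>' borel fst)"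
    then have A [measurable]: "A \<in> sets borel" by simp
    have f\<rho>: "emeasure (dmeas a b \<rho>) A < \<infinity>"
      using emeasure_dmeas_eq_integral[OF \<rho> A] by simp
    have "emeasure (dmeas a b \<alpha>) A \<le> emeasure (dmeas a b \<rho>) A"
      using \<alpha>(2) by (auto simp: emeasure_dmeas indicator_def intro!: nn_integral_mono ennreal_leI)
    then have fin: "ennreal \<epsilon> * emeasure (dmeas a b \<alpha>) A < \<infinity>"
      using f\<rho> by (auto simp: ennreal_mult_less_top intro: le_less_trans)
    have "emeasure (distr \<gamma>' borel fst) A + ennreal \<epsilon> * emeasure (dmeas a b \<alpha>) A
        = (\<integral>\<^sup>+ z. (w z * indicator A (fst z) + v z * indicator A (snd z)) + ennreal \<epsilon> * (indicator G z * indicator A (fst z)) \<partial>\<gamma>)"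
      by (subst marg', simp, simp, subst nn_integral_add, simp, simp) (simp add: nn_integral_cmult \<alpha>(4)[symmetric])
    also have "\<dots> = (\<integral>\<^sup>+ z. indicator A (fst z) + ennreal \<epsilon> * (indicator G z * indicator A (snd z)) \<partial>\<gamma>)"
    proof (rule nn_integral_cong)
      fix z
      have "v z = ennreal \<epsilon> * indicator G z" using \<epsilon> by (simp add: v_def indicator_def)
      then show "(w z * indicator A (fst z) + v z * indicator A (snd z)) + ennreal \<epsilon> * (indicator G z * indicator A (fst z))
        = indicator A (fst z) + ennreal \<epsilon> * (indicator G z * indicator A (snd z))"
        using wv[of z] by (auto simp: indicator_def ac_simps)
    qed
    also have "\<dots> = emeasure (dmeas a b \<rho>) A + ennreal \<epsilon> * emeasure (dmeas a b \<beta>) A"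
    proof -
      have "(\<integral>\<^sup>+ z. indicator A (fst z) \<partial>\<gamma>) = emeasure (distr \<gamma> borel fst) A"
        by (rule emeasure_distr_nn_integral[symmetric]) auto
      then show ?thesis
        by (subst nn_integral_add) (auto simp: nn_integral_cmult \<beta>(4)[symmetric] marg(1))
    qed
    also have "\<dots> = emeasure (dmeas a b ?\<rho>') A + ennreal \<epsilon> * emeasure (dmeas a b \<alpha>) A"
    proof -
      have "ennreal (indicator {a<..<b} x * \<rho> x) * indicator A x + ennreal \<epsilon> * (ennreal (indicator {a<..<b} x * \<beta> x) * indicator A x)
        = ennreal (indicator {a<..<b} x * ?\<rho>' x) * indicator A x + ennreal \<epsilon> * (ennreal (indicator {a<..<b} x * \<alpha> x) * indicator A x)" for x
      proof (cases "x \<in> {a<..<b} \<inter> A")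
        case True
        have "\<epsilon> * \<alpha> x \<le> 1 * \<alpha> x" using \<alpha>(2)[of x] True \<epsilon> by (intro mult_right_mono) auto
        then have "0 \<le> ?\<rho>' x - \<epsilon> * \<beta> x" using \<alpha>(2)[of x] True by auto
        then have "ennreal (\<rho> x + \<epsilon> * \<beta> x) = ennreal (?\<rho>' x) + ennreal (\<epsilon> * \<alpha> x)"
          using \<alpha>(2)[of x] \<beta>(2)[of x] True \<epsilon> by (subst ennreal_plus[symmetric]) auto
        then show ?thesis using \<rho>(2)[of x] \<alpha>(2)[of x] \<beta>(2)[of x] True \<epsilon> by (simp add: ennreal_mult)
      qed auto
      then show ?thesis
        by (simp add: emeasure_dmeas nn_integral_cmult[symmetric] nn_integral_add[symmetric])
    qed
    finally show "emeasure (distr \<gamma>' borel fst) A = emeasure (dmeas a b ?\<rho>') A"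
      using fin by (auto simp: add.commute[of _ "ennreal \<epsilon> * _"] ennreal_add_left_cancel)
  qed simp
  have "\<gamma>' \<in> couplings (dmeas a b ?\<rho>') (dmeas a b \<rho>h)"
    using sets\<gamma>' fst' snd' by (simp add: couplings_def)
  then have "W2sq (dmeas a b ?\<rho>') (dmeas a b \<rho>h) \<le> (\<integral>\<^sup>+ z. ennreal ((fst z - snd z)^2) \<partial>\<gamma>')"
    by (rule W2sq_le)
  also have "\<dots> = (\<integral>\<^sup>+ z. w z * ennreal ((fst z - snd z)^2) \<partial>\<gamma>)"
    by (subst \<gamma>') auto
  also have "\<dots> \<le> (\<integral>\<^sup>+ z. 1 * ennreal ((fst z - snd z)^2) \<partial>\<gamma>)"
    using \<epsilon> by (intro nn_integral_mono mult_right_mono) (auto simp: w_def indicator_def)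
  finally have "W2sq (dmeas a b ?\<rho>') (dmeas a b \<rho>h) \<le> (\<integral>\<^sup>+ z. ennreal ((fst z - snd z)^2) \<partial>\<gamma>)" by simp
  moreover have "emeasure (dmeas a b \<alpha>) UNIV = emeasure \<gamma> (E \<times> Q)" "emeasure (dmeas a b \<beta>) UNIV = emeasure \<gamma> (E \<times> Q)"
    using \<alpha>(4)[of UNIV] \<beta>(4)[of UNIV] G by (auto simp: G_def)
  ultimately show thesis using that \<alpha>(1-3) \<beta>(1-3) by blast
qed

lemma coupling_mass_le:
  assumes \<gamma>: "\<gamma> \<in> couplings \<mu> \<nu>" and [measurable]: "E \<in> sets borel" "Q \<in> sets borel"
  shows "emeasure \<mu> E \<le> emeasure \<gamma> (E \<times> Q) + emeasure \<nu> (- Q)"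
proof -
  have sets\<gamma>: "sets \<gamma> = sets borel" and marg: "distr \<gamma> borel fst = \<mu>" "distr \<gamma> borel snd = \<nu>"
    using \<gamma> by (auto simp: couplings_def)
  note m [measurable] = measurable_fst_snd_borel[OF sets\<gamma>]
  have space: "space \<gamma> = UNIV" using sets_eq_imp_space_eq[OF sets\<gamma>] by simp
  have "emeasure \<mu> E = emeasure \<gamma> (fst -` E)"
    unfolding marg[symmetric] by (subst emeasure_distr) (auto simp: space)
  also have "\<dots> \<le> emeasure \<gamma> ((E \<times> Q) \<union> snd -` (- Q))"
    using measurable_sets[OF m(2), of "- Q"]
    by (intro emeasure_mono) (auto simp: space sets\<gamma> intro!: sets.Un borel_Times)
  also have "\<dots> \<le> emeasure \<gamma> (E \<times> Q) + emeasure \<gamma> (snd -` (- Q))"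
    using measurable_sets[OF m(2), of "- Q"]
    by (intro emeasure_subadditive) (auto simp: space sets\<gamma> intro!: borel_Times)
  also have "emeasure \<gamma> (snd -` (- Q)) = emeasure \<nu> (- Q)"
    unfolding marg[symmetric] by (subst emeasure_distr) (auto simp: space)
  finally show ?thesis .
qed

lemma coupling_swap:
  assumes "\<gamma> \<in> couplings \<mu> \<nu>"
  shows "distr \<gamma> borel (\<lambda>z. (snd z, fst z)) \<in> couplings \<nu> \<mu>"
    and "(\<integral>\<^sup>+ z. ennreal ((fst z - snd z)^2) \<partial>distr \<gamma> borel (\<lambda>z. (snd z, fst z))) = (\<integral>\<^sup>+ z. ennreal ((fst z - snd z)^2) \<partial>\<gamma>)"
proof -
  have sets\<gamma>: "sets \<gamma> = sets borel" and marg: "distr \<gamma> borel fst = \<mu>" "distr \<gamma> borel snd = \<nu>"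
    using assms by (auto simp: couplings_def)
  note [measurable] = measurable_fst_snd_borel[OF sets\<gamma>] measurable_fst_snd_borel[OF refl]
  show "distr \<gamma> borel (\<lambda>z. (snd z, fst z)) \<in> couplings \<nu> \<mu>"
    using marg unfolding couplings_def by (auto simp: distr_distr comp_def)
  show "(\<integral>\<^sup>+ z. ennreal ((fst z - snd z)^2) \<partial>distr \<gamma> borel (\<lambda>z. (snd z, fst z))) = (\<integral>\<^sup>+ z. ennreal ((fst z - snd z)^2) \<partial>\<gamma>)"
    by (subst nn_integral_distr) (auto simp: power2_commute)
qed

lemma W2sq_commute: "W2sq \<mu> \<nu> = W2sq \<nu> \<mu>"
proof -
  have "W2sq \<mu> \<nu> \<le> W2sq \<nu> \<mu>" for \<mu> \<nu>
    unfolding W2sq_def[of \<nu>]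
  proof (rule INF_greatest)
    fix \<gamma> assume \<gamma>: "\<gamma> \<in> couplings \<nu> \<mu>"
    show "W2sq \<mu> \<nu> \<le> (\<integral>\<^sup>+ z. ennreal ((fst z - snd z)^2) \<partial>\<gamma>)"
      using W2sq_le[OF coupling_swap(1)[OF \<gamma>]] unfolding coupling_swap(2)[OF \<gamma>] .
  qed
  then show ?thesis by (simp add: order_antisym)
qed

lemma W2sq_self:
  assumes [measurable_cong]: "sets \<mu> = sets borel"
  shows "W2sq \<mu> \<mu> = 0"
proof -
  note [measurable] = measurable_fst_snd_borel[OF refl]
  have "distr \<mu> borel (\<lambda>x. x) = \<mu>" by (rule distr_id2) (simp add: assms)
  then have "distr \<mu> borel (\<lambda>x. (x, x)) \<in> couplings \<mu> \<mu>"
    by (auto simp: couplings_def distr_distr comp_def)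
  from W2sq_le[OF this] show ?thesis
    by (simp add: nn_integral_distr)
qed

section \<open>The maximum principle for the diffusion step\<close>

lemma set_integrable_interval_bounded:
  fixes f :: "real \<Rightarrow> real"
  assumes "f \<in> borel_measurable borel" "AE x in lborel. x \<in> {a<..<b} \<longrightarrow> \<bar>f x\<bar> \<le> B"
  shows "set_integrable lborel {a<..<b} f"
  unfolding set_integrable_def
  by (rule integrableI_bounded_set_indicator[where B = B]) (use assms emeasure_bounded_finite[of "{a<..<b}"] in auto)

lemma set_integrable_chi_cong:
  assumes "\<And>x. x \<in> A \<Longrightarrow> 0 \<le> f x"
  shows "set_integrable M A (\<lambda>x. chi (f x)) \<longleftrightarrow> set_integrable M A (\<lambda>x. chi (max 0 (f x :: real)))"
  by (rule set_integrable_cong) (use assms in auto)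

lemma internal_energy_integrable:
  fixes f :: "real \<Rightarrow> real"
  assumes chi: "internal_energy_density chi" and [measurable]: "f \<in> borel_measurable borel"
    and nonneg: "\<And>x. x \<in> {a<..<b} \<Longrightarrow> 0 \<le> f x"
    and bound: "AE x in lborel. x \<in> {a<..<b} \<longrightarrow> f x \<le> M"
  shows "set_integrable lborel {a<..<b} (\<lambda>x. chi (f x))"
proof -
  have "set_integrable lborel {a<..<b} (\<lambda>x. chi (max 0 (f x)))"
  proof (rule set_integrable_interval_bounded)
    show "(\<lambda>x. chi (max 0 (f x))) \<in> borel_measurable borel"
      by (rule internal_energy_density_measurable[OF chi]) auto
    show "AE x in lborel. x \<in> {a<..<b} \<longrightarrow> \<bar>chi (max 0 (f x))\<bar> \<le> \<bar>chi 0\<bar> + \<bar>chi M\<bar>"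
      using bound
    proof eventually_elim
      case (elim x)
      show ?case
      proof
        assume x: "x \<in> {a<..<b}"
        then have "0 \<le> f x" "f x \<le> M" using nonneg elim by auto
        then have "chi 0 \<le> chi (f x)" "chi (f x) \<le> chi M"
          by (auto intro: internal_energy_density_mono[OF chi])
        then show "\<bar>chi (max 0 (f x))\<bar> \<le> \<bar>chi 0\<bar> + \<bar>chi M\<bar>" using \<open>0 \<le> f x\<close> by auto
      qed
    qed
  qed
  then show ?thesis
    using set_integrable_chi_cong[of "{a<..<b}" f lborel chi] nonneg by blast
qed

lemma jko_minimiser_compare:
  fixes \<rho>h \<eta>h :: "real \<Rightarrow> real"
  assumes min: "jko_minimiser a b chi \<tau> \<rho>h \<eta>h \<rho> \<eta>" and "0 < \<tau>"
    and adm: "admissible a b (\<integral>x\<in>{a<..<b}. \<rho>h x \<partial>lborel) \<rho>'" "admissible a b (\<integral>x\<in>{a<..<b}. \<eta>h x \<partial>lborel) \<eta>'"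
    and W: "W2sq (dmeas a b \<rho>') (dmeas a b \<rho>h) + W2sq (dmeas a b \<eta>') (dmeas a b \<eta>h) \<le> ennreal c" "0 \<le> c"
    and int: "set_integrable lborel {a<..<b} (\<lambda>x. chi (\<rho>' x + \<eta>' x))"
  obtains w where "0 \<le> w" "W2sq (dmeas a b \<rho>) (dmeas a b \<rho>h) + W2sq (dmeas a b \<eta>) (dmeas a b \<eta>h) = ennreal w"
    "set_integrable lborel {a<..<b} (\<lambda>x. chi (\<rho> x + \<eta> x))"
    "w / (2 * \<tau>) + (\<integral>x\<in>{a<..<b}. chi (\<rho> x + \<eta> x) \<partial>lborel)
      \<le> c / (2 * \<tau>) + (\<integral>x\<in>{a<..<b}. chi (\<rho>' x + \<eta>' x) \<partial>lborel)"
proof -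
  let ?W = "W2sq (dmeas a b \<rho>) (dmeas a b \<rho>h) + W2sq (dmeas a b \<eta>) (dmeas a b \<eta>h)"
  let ?W' = "W2sq (dmeas a b \<rho>') (dmeas a b \<rho>h) + W2sq (dmeas a b \<eta>') (dmeas a b \<eta>h)"
  let ?E' = "\<integral>x\<in>{a<..<b}. chi (\<rho>' x + \<eta>' x) \<partial>lborel"
  have "jko_functional a b chi \<tau> \<rho>h \<eta>h \<rho> \<eta> \<le> jko_functional a b chi \<tau> \<rho>h \<eta>h \<rho>' \<eta>'"
    using min adm unfolding jko_minimiser_def Let_def by blast
  also have "\<dots> = ereal (1 / (2 * \<tau>)) * enn2ereal ?W' + ereal ?E'"
    using int by (simp add: jko_functional_def energy_def)
  also have "\<dots> \<le> ereal (1 / (2 * \<tau>)) * ereal c + ereal ?E'"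
  proof (intro add_right_mono ereal_mult_left_mono)
    show "enn2ereal ?W' \<le> ereal c" using W by (metis enn2ereal_ennreal less_eq_ennreal.rep_eq)
  qed (use \<open>0 < \<tau>\<close> in auto)
  finally have le: "ereal (1 / (2 * \<tau>)) * enn2ereal ?W + energy a b chi \<rho> \<eta> \<le> ereal (c / (2 * \<tau>) + ?E')"
    by (simp add: jko_functional_def)
  have nn: "0 \<le> ereal (1 / (2 * \<tau>)) * enn2ereal ?W" using \<open>0 < \<tau>\<close> by (intro ereal_0_le_mult) auto
  have intg: "set_integrable lborel {a<..<b} (\<lambda>x. chi (\<rho> x + \<eta> x))"
  proof (rule ccontr)
    assume "\<not> ?thesis"
    then have "energy a b chi \<rho> \<eta> = \<infinity>" by (simp add: energy_def)
    then show False using le nn by auto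
  qed
  then have E: "energy a b chi \<rho> \<eta> = ereal (\<integral>x\<in>{a<..<b}. chi (\<rho> x + \<eta> x) \<partial>lborel)" by (simp add: energy_def)
  show thesis
  proof (cases ?W)
    case (real w)
    show thesis
    proof (rule that[OF real(1) real(2) intg])
      show "w / (2 * \<tau>) + (\<integral>x\<in>{a<..<b}. chi (\<rho> x + \<eta> x) \<partial>lborel) \<le> c / (2 * \<tau>) + ?E'"
        using le unfolding E real(2) using real(1) by (simp add: enn2ereal_ennreal)
    qed
  next
    case top
    have "enn2ereal (top::ennreal) = \<infinity>" by (simp add: top_ennreal.rep_eq top_ereal_def)
    then show thesis using le \<open>0 < \<tau>\<close> unfolding top E by simp
  qed
qed

lemma jko_energy_dissipation:
  fixes \<rho>h \<eta>h :: "real \<Rightarrow> real"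
  assumes chi: "internal_energy_density chi" and "0 < \<tau>"
    and m [measurable]: "\<rho>h \<in> borel_measurable borel" "\<eta>h \<in> borel_measurable borel"
    and nonneg: "\<And>x. x \<in> {a<..<b} \<Longrightarrow> 0 \<le> \<rho>h x" "\<And>x. x \<in> {a<..<b} \<Longrightarrow> 0 \<le> \<eta>h x"
    and bound: "AE x in lborel. x \<in> {a<..<b} \<longrightarrow> \<rho>h x + \<eta>h x \<le> M"
    and min: "jko_minimiser a b chi \<tau> \<rho>h \<eta>h \<rho> \<eta>"
  obtains w where "0 \<le> w" "W2sq (dmeas a b \<rho>) (dmeas a b \<rho>h) + W2sq (dmeas a b \<eta>) (dmeas a b \<eta>h) = ennreal w"
    "set_integrable lborel {a<..<b} (\<lambda>x. chi (\<rho> x + \<eta> x))"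
    "w / (2 * \<tau>) + (\<integral>x\<in>{a<..<b}. chi (\<rho> x + \<eta> x) \<partial>lborel)
      \<le> (\<integral>x\<in>{a<..<b}. chi (\<rho>h x + \<eta>h x) \<partial>lborel)"
    "set_integrable lborel {a<..<b} \<rho>h" "set_integrable lborel {a<..<b} \<eta>h"
proof -
  have ih: "set_integrable lborel {a<..<b} \<rho>h" "set_integrable lborel {a<..<b} \<eta>h"
    by (rule set_integrable_interval_bounded[where B = M], measurable, use bound in eventually_elim,
        use nonneg in fastforce)+
  have adm: "admissible a b (\<integral>x\<in>{a<..<b}. \<rho>h x \<partial>lborel) \<rho>h" "admissible a b (\<integral>x\<in>{a<..<b}. \<eta>h x \<partial>lborel) \<eta>h"
    using ih nonneg m by (auto simp: admissible_def)
  have W: "W2sq (dmeas a b \<rho>h) (dmeas a b \<rho>h) + W2sq (dmeas a b \<eta>h) (dmeas a b \<eta>h) \<le> ennreal 0"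
    by (simp add: W2sq_self)
  have "set_integrable lborel {a<..<b} (\<lambda>x. chi (\<rho>h x + \<eta>h x))"
    by (rule internal_energy_integrable[OF chi _ _ bound]) (use nonneg in \<open>auto simp: add_nonneg_nonneg\<close>)
  from jko_minimiser_compare[OF min \<open>0 < \<tau>\<close> adm W order_refl this] obtain w where "0 \<le> w"
    "W2sq (dmeas a b \<rho>) (dmeas a b \<rho>h) + W2sq (dmeas a b \<eta>) (dmeas a b \<eta>h) = ennreal w"
    "set_integrable lborel {a<..<b} (\<lambda>x. chi (\<rho> x + \<eta> x))"
    "w / (2 * \<tau>) + (\<integral>x\<in>{a<..<b}. chi (\<rho> x + \<eta> x) \<partial>lborel)
      \<le> 0 / (2 * \<tau>) + (\<integral>x\<in>{a<..<b}. chi (\<rho>h x + \<eta>h x) \<partial>lborel)" .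
  then show thesis using that ih by simp
qed

lemma W2sq_near_optimal_coupling:
  assumes "W2sq \<mu> \<nu> = ennreal w" "0 \<le> w" "0 < \<theta>"
  obtains \<gamma> where "\<gamma> \<in> couplings \<mu> \<nu>" "(\<integral>\<^sup>+ z. ennreal ((fst z - snd z)^2) \<partial>\<gamma>) \<le> ennreal (w + \<theta>)"
proof -
  have "W2sq \<mu> \<nu> < ennreal (w + \<theta>)" using assms by (simp add: ennreal_less_iff)
  then show ?thesis unfolding W2sq_def INF_less_iff using that less_imp_le by blast
qed

lemma density_back_transport:
  assumes f: "f \<in> borel_measurable borel" "\<And>x. x \<in> {a<..<b} \<Longrightarrow> 0 \<le> f x" "set_integrable lborel {a<..<b} f"
    and fh: "fh \<in> borel_measurable borel" "\<And>x. x \<in> {a<..<b} \<Longrightarrow> 0 \<le> fh x" "set_integrable lborel {a<..<b} fh"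
    and \<gamma>: "\<gamma> \<in> couplings (dmeas a b f) (dmeas a b fh)"
    and [measurable]: "E \<in> sets borel" "Q \<in> sets borel" and \<epsilon>: "0 < \<epsilon>" "\<epsilon> \<le> 1"
  shows "\<exists>\<alpha> \<beta>. \<alpha> \<in> borel_measurable borel \<and> \<beta> \<in> borel_measurable borel
      \<and> (\<forall>x\<in>{a<..<b}. 0 \<le> \<alpha> x \<and> \<alpha> x \<le> f x \<and> 0 \<le> \<beta> x \<and> \<beta> x \<le> fh x)
      \<and> (\<forall>x. (x \<notin> E \<longrightarrow> \<alpha> x = 0) \<and> (x \<notin> Q \<longrightarrow> \<beta> x = 0))
      \<and> set_integrable lborel {a<..<b} \<alpha> \<and> set_integrable lborel {a<..<b} \<beta>
      \<and> (\<integral>x\<in>{a<..<b}. \<alpha> x \<partial>lborel) = (\<integral>x\<in>{a<..<b}. \<beta> x \<partial>lborel)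
      \<and> (\<integral>x\<in>{a<..<b}. indicator E x * f x \<partial>lborel) \<le> (\<integral>x\<in>{a<..<b}. \<alpha> x \<partial>lborel) + (\<integral>x\<in>{a<..<b}. indicator (- Q) x * fh x \<partial>lborel)
      \<and> admissible a b (\<integral>x\<in>{a<..<b}. f x \<partial>lborel) (\<lambda>x. f x - \<epsilon> * \<alpha> x + \<epsilon> * \<beta> x)
      \<and> W2sq (dmeas a b (\<lambda>x. f x - \<epsilon> * \<alpha> x + \<epsilon> * \<beta> x)) (dmeas a b fh) \<le> (\<integral>\<^sup>+ z. ennreal ((fst z - snd z)^2) \<partial>\<gamma>)"
proof -
  obtain \<alpha> \<beta> where \<alpha>: "\<alpha> \<in> borel_measurable borel" "\<And>x. x \<in> {a<..<b} \<Longrightarrow> 0 \<le> \<alpha> x \<and> \<alpha> x \<le> f x" "\<And>x. x \<notin> E \<Longrightarrow> \<alpha> x = 0"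
    and \<beta>: "\<beta> \<in> borel_measurable borel" "\<And>x. x \<in> {a<..<b} \<Longrightarrow> 0 \<le> \<beta> x \<and> \<beta> x \<le> fh x" "\<And>x. x \<notin> Q \<Longrightarrow> \<beta> x = 0"
    and mass: "emeasure (dmeas a b \<alpha>) UNIV = emeasure \<gamma> (E \<times> Q)" "emeasure (dmeas a b \<beta>) UNIV = emeasure \<gamma> (E \<times> Q)"
    and cost: "W2sq (dmeas a b (\<lambda>x. f x - \<epsilon> * \<alpha> x + \<epsilon> * \<beta> x)) (dmeas a b fh) \<le> (\<integral>\<^sup>+ z. ennreal ((fst z - snd z)^2) \<partial>\<gamma>)"
    by (rule coupling_back_transport[OF f fh \<gamma> \<open>E \<in> sets borel\<close> \<open>Q \<in> sets borel\<close> less_imp_le[OF \<epsilon>(1)] \<epsilon>(2)])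
      (assumption, assumption, rule that)
  note [measurable] = f(1) fh(1) \<alpha>(1) \<beta>(1)
  have dom: "set_integrable lborel {a<..<b} g" if [measurable]: "g \<in> borel_measurable borel"
    and "\<And>x. x \<in> {a<..<b} \<Longrightarrow> 0 \<le> g x \<and> g x \<le> k x" and "set_integrable lborel {a<..<b} k" for g k :: "real \<Rightarrow> real"
    using that(3) unfolding set_integrable_def
    by (rule Bochner_Integration.integrable_bound) (use that(2) in \<open>force simp: indicator_def\<close>)+
  have ia: "set_integrable lborel {a<..<b} \<alpha>" by (rule dom[OF \<alpha>(1,2) f(3)])
  have ib: "set_integrable lborel {a<..<b} \<beta>" by (rule dom[OF \<beta>(1,2) fh(3)])
  have a0: "0 \<le> (\<integral>x\<in>{a<..<b}. \<alpha> x \<partial>lborel)" and b0: "0 \<le> (\<integral>x\<in>{a<..<b}. \<beta> x \<partial>lborel)"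
    unfolding set_lebesgue_integral_def using \<alpha>(2) \<beta>(2) by (auto intro!: integral_nonneg_AE simp: indicator_def)
  have ma: "emeasure \<gamma> (E \<times> Q) = ennreal (\<integral>x\<in>{a<..<b}. \<alpha> x \<partial>lborel)"
    using emeasure_dmeas_eq_integral[OF \<alpha>(1) _ ia, of UNIV] \<alpha>(2) mass(1) by simp
  have mb: "emeasure \<gamma> (E \<times> Q) = ennreal (\<integral>x\<in>{a<..<b}. \<beta> x \<partial>lborel)"
    using emeasure_dmeas_eq_integral[OF \<beta>(1) _ ib, of UNIV] \<beta>(2) mass(2) by simp
  have ab: "(\<integral>x\<in>{a<..<b}. \<alpha> x \<partial>lborel) = (\<integral>x\<in>{a<..<b}. \<beta> x \<partial>lborel)" using ma mb a0 b0 by simp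
  have fhQ: "0 \<le> (\<integral>x\<in>{a<..<b}. indicator (- Q) x * fh x \<partial>lborel)"
    unfolding set_lebesgue_integral_def using fh(2) by (auto intro!: integral_nonneg_AE simp: indicator_def)
  have "ennreal (\<integral>x\<in>{a<..<b}. indicator E x * f x \<partial>lborel) \<le> ennreal (\<integral>x\<in>{a<..<b}. \<alpha> x \<partial>lborel) + ennreal (\<integral>x\<in>{a<..<b}. indicator (- Q) x * fh x \<partial>lborel)"
    using coupling_mass_le[OF \<gamma> \<open>E \<in> sets borel\<close> \<open>Q \<in> sets borel\<close>]
    unfolding ma by (subst (asm) (1 2) emeasure_dmeas_eq_integral) (use f fh in auto)
  then have mass_le: "(\<integral>x\<in>{a<..<b}. indicator E x * f x \<partial>lborel) \<le> (\<integral>x\<in>{a<..<b}. \<alpha> x \<partial>lborel) + (\<integral>x\<in>{a<..<b}. indicator (- Q) x * fh x \<partial>lborel)"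
    using a0 fhQ by (simp flip: ennreal_plus)
  have "admissible a b (\<integral>x\<in>{a<..<b}. f x \<partial>lborel) (\<lambda>x. f x - \<epsilon> * \<alpha> x + \<epsilon> * \<beta> x)"
    unfolding admissible_def
  proof (intro conjI ballI)
    show "(\<lambda>x. f x - \<epsilon> * \<alpha> x + \<epsilon> * \<beta> x) \<in> borel_measurable borel" by measurable
    show "0 \<le> f x - \<epsilon> * \<alpha> x + \<epsilon> * \<beta> x" if "x \<in> {a<..<b}" for x
    proof -
      have "\<epsilon> * \<alpha> x \<le> 1 * \<alpha> x" using \<alpha>(2)[OF that] \<epsilon> by (intro mult_right_mono) auto
      then show ?thesis using \<alpha>(2)[OF that] \<beta>(2)[OF that] \<epsilon> by (simp add: add_nonneg_nonneg)
    qed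
    show "set_integrable lborel {a<..<b} (\<lambda>x. f x - \<epsilon> * \<alpha> x + \<epsilon> * \<beta> x)"
      using f(3) ia ib by (intro set_integral_add set_integral_diff set_integrable_mult_right) auto
    show "(\<integral>x\<in>{a<..<b}. (f x - \<epsilon> * \<alpha> x + \<epsilon> * \<beta> x) \<partial>lborel) = (\<integral>x\<in>{a<..<b}. f x \<partial>lborel)"
      using f(3) ia ib ab by (simp add: set_integral_add set_integral_diff)
  qed
  then show ?thesis using \<alpha> \<beta> ia ib ab mass_le cost
    by (intro exI[of _ \<alpha>] exI[of _ \<beta>]) auto
qed

text \<open>The level \<open>s < t\<close> is taken so close to \<open>t\<close> that \<open>M |{\<sigma> > s}| < t |{\<sigma> \<ge> t}|\<close>. Every coupling then carries at least
  the mass \<open>m0 > 0\<close> between \<open>E = {\<sigma> \<ge> t}\<close> and \<open>Q = {\<sigma> \<le> s}\<close>; as \<open>m0\<close> does not depend on the coupling,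
  near-optimal couplings suffice and no optimal plan has to be constructed.\<close>

lemma jko_level_set_null:
  fixes \<rho>h \<eta>h :: "real \<Rightarrow> real"
  assumes chi: "internal_energy_density chi" and "0 < \<tau>" and "0 < M" and "M < t"
    and m\<rho>h [measurable]: "\<rho>h \<in> borel_measurable borel" and m\<eta>h [measurable]: "\<eta>h \<in> borel_measurable borel"
    and nonneg: "\<And>x. x \<in> {a<..<b} \<Longrightarrow> 0 \<le> \<rho>h x" "\<And>x. x \<in> {a<..<b} \<Longrightarrow> 0 \<le> \<eta>h x"
    and bound: "AE x in lborel. x \<in> {a<..<b} \<longrightarrow> \<rho>h x + \<eta>h x \<le> M"
    and min: "jko_minimiser a b chi \<tau> \<rho>h \<eta>h \<rho> \<eta>"
  shows "measure lborel {x\<in>{a<..<b}. t \<le> \<rho> x + \<eta> x} = 0"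
proof (rule ccontr)
  let ?I = "{a<..<b}"
  define \<sigma> where "\<sigma> x = \<rho> x + \<eta> x" for x
  have adm: "\<rho> \<in> borel_measurable borel" "\<And>x. x \<in> ?I \<Longrightarrow> 0 \<le> \<rho> x" "set_integrable lborel ?I \<rho>"
      "(\<integral>x\<in>?I. \<rho> x \<partial>lborel) = (\<integral>x\<in>?I. \<rho>h x \<partial>lborel)"
    "\<eta> \<in> borel_measurable borel" "\<And>x. x \<in> ?I \<Longrightarrow> 0 \<le> \<eta> x" "set_integrable lborel ?I \<eta>"
      "(\<integral>x\<in>?I. \<eta> x \<partial>lborel) = (\<integral>x\<in>?I. \<eta>h x \<partial>lborel)"
    using min unfolding jko_minimiser_def Let_def admissible_def by auto
  note [measurable] = adm(1,5)
  have m\<sigma> [measurable]: "\<sigma> \<in> borel_measurable borel" unfolding \<sigma>_def by measurable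
  assume "measure lborel {x\<in>?I. t \<le> \<rho> x + \<eta> x} \<noteq> 0"
  then have Epos: "0 < measure lborel {x\<in>?I. t \<le> \<sigma> x}" by (simp add: \<sigma>_def zero_less_measure_iff)
  define V where "V n = {x\<in>?I. t - 1 / real (Suc n) < \<sigma> x}" for n
  have V [measurable]: "V n \<in> sets borel" for n unfolding V_def by measurable
  have Vfin: "emeasure lborel (V n) \<noteq> \<infinity>" for n
  proof -
    have "bounded (V n)" by (rule bounded_subset[of ?I]) (auto simp: V_def)
    from emeasure_bounded_finite[OF this] show ?thesis by simp
  qed
  have "(\<lambda>n. measure lborel (V n)) \<longlonglongrightarrow> measure lborel (\<Inter>n. V n)"
  proof (rule Lim_measure_decseq)
    show "range V \<subseteq> sets lborel" using V by auto
    show "decseq V"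
    proof (rule decseq_SucI, rule subsetI)
      fix n x assume "x \<in> V (Suc n)"
      moreover have "1 / real (Suc (Suc n)) \<le> 1 / real (Suc n)" by (simp add: field_simps)
      ultimately show "x \<in> V n" unfolding V_def by (auto simp del: of_nat_Suc)
    qed
  qed (rule Vfin)
  moreover have "(\<Inter>n. V n) = {x\<in>?I. t \<le> \<sigma> x}"
  proof (intro equalityI subsetI)
    fix x assume x: "x \<in> (\<Inter>n. V n)"
    have "t \<le> \<sigma> x"
    proof (rule ccontr)
      assume "\<not> t \<le> \<sigma> x"
      then obtain n where "inverse (real (Suc n)) < t - \<sigma> x" using reals_Archimedean[of "t - \<sigma> x"] by auto
      moreover have "t - 1 / real (Suc n) < \<sigma> x" using x by (auto simp: V_def simp del: of_nat_Suc)
      ultimately show False by (simp add: inverse_eq_divide)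
    qed
    then show "x \<in> {x\<in>?I. t \<le> \<sigma> x}" using x by (auto simp: V_def)
  next
    fix x assume x: "x \<in> {x\<in>?I. t \<le> \<sigma> x}"
    have "t - 1 / real (Suc n) < \<sigma> x" for n
    proof -
      have "0 < 1 / real (Suc n)" "t \<le> \<sigma> x" using x by auto
      then show ?thesis by linarith
    qed
    then show "x \<in> (\<Inter>n. V n)" using x by (auto simp: V_def)
  qed
  ultimately have "(\<lambda>n. M * measure lborel (V n)) \<longlonglongrightarrow> M * measure lborel {x\<in>?I. t \<le> \<sigma> x}"
    by (auto intro: tendsto_intros)
  moreover have "M * measure lborel {x\<in>?I. t \<le> \<sigma> x} < t * measure lborel {x\<in>?I. t \<le> \<sigma> x}"
    using Epos \<open>M < t\<close> by simp
  ultimately have ev1: "\<forall>\<^sub>F n in sequentially. M * measure lborel (V n) < t * measure lborel {x\<in>?I. t \<le> \<sigma> x}"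
    by (rule order_tendstoD(2))
  have "(\<lambda>n. t - 1 / real (Suc n)) \<longlonglongrightarrow> t - 0"
    by (intro tendsto_intros LIMSEQ_Suc[OF lim_1_over_n])
  from order_tendstoD(1)[OF this, of 0]
  have ev2: "\<forall>\<^sub>F n in sequentially. 0 < t - 1 / real (Suc n)"
    using \<open>0 < M\<close> \<open>M < t\<close> by (simp del: of_nat_Suc)
  obtain n where n: "M * measure lborel (V n) < t * measure lborel {x\<in>?I. t \<le> \<sigma> x}" "0 < t - 1 / real (Suc n)"
    using eventually_happens[OF eventually_conj[OF ev1 ev2]] by auto
  define s where "s = t - 1 / real (Suc n)"
  have s: "0 < s" "s < t" using n(2) by (auto simp: s_def)
  define E where "E = {x. t \<le> \<sigma> x}"
  define Q where "Q = {x. \<sigma> x \<le> s}"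
  have [measurable]: "E \<in> sets borel" "Q \<in> sets borel" unfolding E_def Q_def by measurable
  have EV: "{x\<in>?I. t \<le> \<sigma> x} = ?I \<inter> E" "V n = ?I \<inter> (- Q)"
    by (auto simp: E_def Q_def V_def s_def)
  define m0 where "m0 = t * measure lborel (?I \<inter> E) - M * measure lborel (?I \<inter> (- Q))"
  have m0: "0 < m0" using n(1) unfolding EV m0_def by simp
  define \<epsilon> where "\<epsilon> = (t - s) / (2 * (t + M))"
  have tM: "0 < t + M" "0 < t" using \<open>0 < M\<close> \<open>M < t\<close> by auto
  have \<epsilon>: "0 < \<epsilon>" "\<epsilon> \<le> 1" "s + \<epsilon> * M < (1 - \<epsilon>) * t"
  proof -
    show "0 < \<epsilon>" using s tM by (simp add: \<epsilon>_def)
    show "\<epsilon> \<le> 1" using s tM \<open>0 < M\<close> by (simp add: \<epsilon>_def field_simps)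
    have "\<epsilon> * (t + M) = (t - s) / 2" using tM by (simp add: \<epsilon>_def field_simps)
    then have "(1 - \<epsilon>) * t - (s + \<epsilon> * M) = (t - s) / 2" by (simp add: algebra_simps)
    then have "0 < (1 - \<epsilon>) * t - (s + \<epsilon> * M)" by (simp only:) (use s in simp)
    then show "s + \<epsilon> * M < (1 - \<epsilon>) * t" by (simp only: diff_gt_0_iff_gt)
  qed
  define D1 where "D1 = deriv chi ((1 - \<epsilon>) * t)"
  define D2 where "D2 = deriv chi (s + \<epsilon> * M)"
  have low: "0 < s + \<epsilon> * M" using s \<epsilon> \<open>0 < M\<close> by (simp add: add_pos_pos)
  have D: "D2 < D1" unfolding D1_def D2_def
    using internal_energy_densityD(3)[OF chi low \<epsilon>(3)] .
  define \<theta> where "\<theta> = \<tau> * (\<epsilon> * (D1 - D2) * m0) / 2"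
  have \<theta>: "0 < \<theta>" using \<epsilon> D m0 \<open>0 < \<tau>\<close> by (simp add: \<theta>_def)
  from jko_energy_dissipation[OF chi \<open>0 < \<tau>\<close> m\<rho>h m\<eta>h nonneg bound min]
  obtain w where w: "0 \<le> w"
    "W2sq (dmeas a b \<rho>) (dmeas a b \<rho>h) + W2sq (dmeas a b \<eta>) (dmeas a b \<eta>h) = ennreal w"
    and ichi: "set_integrable lborel ?I (\<lambda>x. chi (\<rho> x + \<eta> x))"
    and ih: "set_integrable lborel ?I \<rho>h" "set_integrable lborel ?I \<eta>h" .
  obtain w1 w2 where w12: "0 \<le> w1" "0 \<le> w2" "W2sq (dmeas a b \<rho>) (dmeas a b \<rho>h) = ennreal w1"
    "W2sq (dmeas a b \<eta>) (dmeas a b \<eta>h) = ennreal w2"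
    using w(2) by (cases "W2sq (dmeas a b \<rho>) (dmeas a b \<rho>h)"; cases "W2sq (dmeas a b \<eta>) (dmeas a b \<eta>h)") auto
  then have ww: "w = w1 + w2" using w by (simp flip: ennreal_plus)
  from W2sq_near_optimal_coupling[OF w12(3,1) \<theta>] obtain \<gamma>1 where \<gamma>1: "\<gamma>1 \<in> couplings (dmeas a b \<rho>) (dmeas a b \<rho>h)"
    "(\<integral>\<^sup>+ z. ennreal ((fst z - snd z)^2) \<partial>\<gamma>1) \<le> ennreal (w1 + \<theta>)" .
  from W2sq_near_optimal_coupling[OF w12(4,2) \<theta>] obtain \<gamma>2 where \<gamma>2: "\<gamma>2 \<in> couplings (dmeas a b \<eta>) (dmeas a b \<eta>h)"
    "(\<integral>\<^sup>+ z. ennreal ((fst z - snd z)^2) \<partial>\<gamma>2) \<le> ennreal (w2 + \<theta>)" .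
  from density_back_transport[OF adm(1-3) m\<rho>h nonneg(1) ih(1) \<gamma>1(1) \<open>E \<in> sets borel\<close> \<open>Q \<in> sets borel\<close> \<epsilon>(1,2)]
  obtain \<alpha>1 \<beta>1 where 1: "\<alpha>1 \<in> borel_measurable borel" "\<beta>1 \<in> borel_measurable borel"
      "\<And>x. x \<in> ?I \<Longrightarrow> 0 \<le> \<alpha>1 x \<and> \<alpha>1 x \<le> \<rho> x \<and> 0 \<le> \<beta>1 x \<and> \<beta>1 x \<le> \<rho>h x"
      "\<And>x. x \<notin> E \<Longrightarrow> \<alpha>1 x = 0" "\<And>x. x \<notin> Q \<Longrightarrow> \<beta>1 x = 0"
      "set_integrable lborel ?I \<alpha>1" "set_integrable lborel ?I \<beta>1"
      "(\<integral>x\<in>?I. \<alpha>1 x \<partial>lborel) = (\<integral>x\<in>?I. \<beta>1 x \<partial>lborel)"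
      "(\<integral>x\<in>?I. indicator E x * \<rho> x \<partial>lborel) \<le> (\<integral>x\<in>?I. \<alpha>1 x \<partial>lborel) + (\<integral>x\<in>?I. indicator (- Q) x * \<rho>h x \<partial>lborel)"
      "admissible a b (\<integral>x\<in>?I. \<rho> x \<partial>lborel) (\<lambda>x. \<rho> x - \<epsilon> * \<alpha>1 x + \<epsilon> * \<beta>1 x)"
      "W2sq (dmeas a b (\<lambda>x. \<rho> x - \<epsilon> * \<alpha>1 x + \<epsilon> * \<beta>1 x)) (dmeas a b \<rho>h) \<le> (\<integral>\<^sup>+ z. ennreal ((fst z - snd z)^2) \<partial>\<gamma>1)"
    by blast
  from density_back_transport[OF adm(5-7) m\<eta>h nonneg(2) ih(2) \<gamma>2(1) \<open>E \<in> sets borel\<close> \<open>Q \<in> sets borel\<close> \<epsilon>(1,2)]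
  obtain \<alpha>2 \<beta>2 where 2: "\<alpha>2 \<in> borel_measurable borel" "\<beta>2 \<in> borel_measurable borel"
      "\<And>x. x \<in> ?I \<Longrightarrow> 0 \<le> \<alpha>2 x \<and> \<alpha>2 x \<le> \<eta> x \<and> 0 \<le> \<beta>2 x \<and> \<beta>2 x \<le> \<eta>h x"
      "\<And>x. x \<notin> E \<Longrightarrow> \<alpha>2 x = 0" "\<And>x. x \<notin> Q \<Longrightarrow> \<beta>2 x = 0"
      "set_integrable lborel ?I \<alpha>2" "set_integrable lborel ?I \<beta>2"
      "(\<integral>x\<in>?I. \<alpha>2 x \<partial>lborel) = (\<integral>x\<in>?I. \<beta>2 x \<partial>lborel)"
      "(\<integral>x\<in>?I. indicator E x * \<eta> x \<partial>lborel) \<le> (\<integral>x\<in>?I. \<alpha>2 x \<partial>lborel) + (\<integral>x\<in>?I. indicator (- Q) x * \<eta>h x \<partial>lborel)"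
      "admissible a b (\<integral>x\<in>?I. \<eta> x \<partial>lborel) (\<lambda>x. \<eta> x - \<epsilon> * \<alpha>2 x + \<epsilon> * \<beta>2 x)"
      "W2sq (dmeas a b (\<lambda>x. \<eta> x - \<epsilon> * \<alpha>2 x + \<epsilon> * \<beta>2 x)) (dmeas a b \<eta>h) \<le> (\<integral>\<^sup>+ z. ennreal ((fst z - snd z)^2) \<partial>\<gamma>2)"
    by blast
  note [measurable] = 1(1,2) 2(1,2)
  define \<rho>' where "\<rho>' x = \<rho> x - \<epsilon> * \<alpha>1 x + \<epsilon> * \<beta>1 x" for x
  define \<eta>' where "\<eta>' x = \<eta> x - \<epsilon> * \<alpha>2 x + \<epsilon> * \<beta>2 x" for x
  have adm': "admissible a b (\<integral>x\<in>?I. \<rho>h x \<partial>lborel) \<rho>'" "admissible a b (\<integral>x\<in>?I. \<eta>h x \<partial>lborel) \<eta>'"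
    using 1(10) 2(10) unfolding \<rho>'_def[abs_def] \<eta>'_def[abs_def] adm(4,8) by auto
  then have [measurable]: "\<rho>' \<in> borel_measurable borel" "\<eta>' \<in> borel_measurable borel"
    and nonneg': "\<And>x. x \<in> ?I \<Longrightarrow> 0 \<le> \<rho>' x" "\<And>x. x \<in> ?I \<Longrightarrow> 0 \<le> \<eta>' x"
    by (auto simp: admissible_def)
  define \<alpha> where "\<alpha> x = \<alpha>1 x + \<alpha>2 x" for x
  define \<beta> where "\<beta> x = \<beta>1 x + \<beta>2 x" for x
  have i\<alpha>: "set_integrable lborel ?I \<alpha>" and i\<beta>: "set_integrable lborel ?I \<beta>"
    unfolding \<alpha>_def[abs_def] \<beta>_def[abs_def] using 1(6,7) 2(6,7) by (auto intro: set_integral_add)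
  define m where "m = (\<integral>x\<in>?I. \<alpha> x \<partial>lborel)"
  have m\<alpha>: "m = (\<integral>x\<in>?I. \<alpha>1 x \<partial>lborel) + (\<integral>x\<in>?I. \<alpha>2 x \<partial>lborel)"
    unfolding m_def \<alpha>_def[abs_def] using 1(6) 2(6) by (simp add: set_integral_add)
  have m\<beta>: "m = (\<integral>x\<in>?I. \<beta> x \<partial>lborel)"
    unfolding m\<alpha> \<beta>_def[abs_def] using 1(7,8) 2(7,8) by (simp add: set_integral_add)
  have part: "set_integrable lborel ?I (\<lambda>x. indicator A x * f x)"
    if "set_integrable lborel ?I f" "A \<in> sets borel" for A and f :: "real \<Rightarrow> real"
  proof -
    have "integrable lborel (\<lambda>x. indicator A x *\<^sub>R (indicator ?I x *\<^sub>R f x))"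
      using that unfolding set_integrable_def by (intro integrable_mult_indicator[where f = "\<lambda>x. indicator ?I x *\<^sub>R f x"]) auto
    then show ?thesis unfolding set_integrable_def by (simp add: ac_simps)
  qed
  have const: "set_integrable lborel ?I (\<lambda>x. indicator A x * c)" "(\<integral>x\<in>?I. indicator A x * c \<partial>lborel) = c * measure lborel (?I \<inter> A)"
    if [measurable]: "A \<in> sets borel" for A and c :: real
  proof -
    show "set_integrable lborel ?I (\<lambda>x. indicator A x * c)"
      by (rule set_integrable_interval_bounded[where B = "\<bar>c\<bar>"]) (auto simp: indicator_def)
    have "(\<integral>x\<in>?I. indicator A x * c \<partial>lborel) = (\<integral>x. indicator (?I \<inter> A) x * c \<partial>lborel)"
      unfolding set_lebesgue_integral_def by (rule Bochner_Integration.integral_cong) (auto simp: indicator_def)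
    also have "\<dots> = c * measure lborel (?I \<inter> A)"
      by simp
    finally show "(\<integral>x\<in>?I. indicator A x * c \<partial>lborel) = c * measure lborel (?I \<inter> A)" .
  qed
  have mm: "m0 \<le> m"
  proof -
    have "t * measure lborel (?I \<inter> E) = (\<integral>x\<in>?I. indicator E x * t \<partial>lborel)"
      by (rule const(2)[symmetric]) simp
    also have "\<dots> \<le> (\<integral>x\<in>?I. (indicator E x * \<rho> x + indicator E x * \<eta> x) \<partial>lborel)"
      using adm(3,7) by (intro set_integral_mono const set_integral_add part) (auto simp: indicator_def E_def \<sigma>_def)
    also have "\<dots> = (\<integral>x\<in>?I. indicator E x * \<rho> x \<partial>lborel) + (\<integral>x\<in>?I. indicator E x * \<eta> x \<partial>lborel)"
      using adm(3,7) by (intro set_integral_add part) auto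
    finally have A: "t * measure lborel (?I \<inter> E) \<le> (\<integral>x\<in>?I. indicator E x * \<rho> x \<partial>lborel) + (\<integral>x\<in>?I. indicator E x * \<eta> x \<partial>lborel)" .
    have "(\<integral>x\<in>?I. indicator (- Q) x * \<rho>h x \<partial>lborel) + (\<integral>x\<in>?I. indicator (- Q) x * \<eta>h x \<partial>lborel)
        = (\<integral>x\<in>?I. (indicator (- Q) x * \<rho>h x + indicator (- Q) x * \<eta>h x) \<partial>lborel)"
      using ih by (intro set_integral_add(2)[symmetric] part) auto
    also have "\<dots> \<le> (\<integral>x\<in>?I. indicator (- Q) x * M \<partial>lborel)"
    proof (rule set_integral_mono_AE)
      show "AE x\<in>?I in lborel. indicator (- Q) x * \<rho>h x + indicator (- Q) x * \<eta>h x \<le> indicator (- Q) x * M"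
        using bound by eventually_elim (auto simp: indicator_def)
    qed (use ih in \<open>auto intro!: const set_integral_add part\<close>)
    also have "\<dots> = M * measure lborel (?I \<inter> (- Q))" by (rule const(2)) simp
    finally show ?thesis using A 1(9) 2(9) unfolding m0_def m\<alpha> by linarith
  qed
  have pointwise: "AE x in lborel. x \<in> ?I \<longrightarrow> chi (\<rho>' x + \<eta>' x) \<le> chi (\<rho> x + \<eta> x) - \<epsilon> * D1 * \<alpha> x + \<epsilon> * D2 * \<beta> x"
    using bound
  proof eventually_elim
    case (elim x)
    show ?case
    proof
      assume x: "x \<in> ?I"
      have h: "0 \<le> \<alpha> x" "\<alpha> x \<le> \<sigma> x" "0 \<le> \<beta> x" "\<beta> x \<le> M"
        using 1(3)[OF x] 2(3)[OF x] elim x by (auto simp: \<alpha>_def \<beta>_def \<sigma>_def)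
      have \<sigma>': "\<rho>' x + \<eta>' x = \<sigma> x - \<epsilon> * \<alpha> x + \<epsilon> * \<beta> x"
        by (simp add: \<rho>'_def \<eta>'_def \<sigma>_def \<alpha>_def \<beta>_def algebra_simps)
      have \<sigma>0: "0 \<le> \<sigma> x" using h by linarith
      consider "x \<in> E" | "x \<in> Q" "x \<notin> E" | "x \<notin> E" "x \<notin> Q" by blast
      then have "chi (\<sigma> x - \<epsilon> * \<alpha> x + \<epsilon> * \<beta> x) \<le> chi (\<sigma> x) - \<epsilon> * D1 * \<alpha> x + \<epsilon> * D2 * \<beta> x"
      proof cases
        case 1
        then have "x \<notin> Q" using s by (auto simp: E_def Q_def)
        then have \<beta>0: "\<beta> x = 0" using \<open>\<And>x. x \<notin> Q \<Longrightarrow> \<beta>1 x = 0\<close> \<open>\<And>x. x \<notin> Q \<Longrightarrow> \<beta>2 x = 0\<close> by (simp add: \<beta>_def)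
        have "(1 - \<epsilon>) * t \<le> (1 - \<epsilon>) * \<sigma> x" using 1 \<epsilon> by (intro mult_left_mono) (auto simp: E_def)
        also have "\<dots> = \<sigma> x - \<epsilon> * \<sigma> x" by (simp add: algebra_simps)
        also have "\<dots> \<le> \<sigma> x - \<epsilon> * \<alpha> x" using h \<epsilon> by (simp add: mult_left_mono)
        finally have "(\<sigma> x - (\<sigma> x - \<epsilon> * \<alpha> x)) * D1 \<le> chi (\<sigma> x) - chi (\<sigma> x - \<epsilon> * \<alpha> x)"
          unfolding D1_def using h \<epsilon> low
          by (intro internal_energy_density_increment_ge[OF chi]) auto
        then show ?thesis by (simp add: \<beta>0 algebra_simps)
      next
        case 2
        have \<alpha>0: "\<alpha> x = 0" using \<open>x \<notin> E\<close> \<open>\<And>x. x \<notin> E \<Longrightarrow> \<alpha>1 x = 0\<close> \<open>\<And>x. x \<notin> E \<Longrightarrow> \<alpha>2 x = 0\<close> by (simp add: \<alpha>_def)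
        have "\<sigma> x + \<epsilon> * \<beta> x \<le> s + \<epsilon> * M" using 2 h \<epsilon> by (intro add_mono mult_left_mono) (auto simp: Q_def)
        then have "chi (\<sigma> x + \<epsilon> * \<beta> x) - chi (\<sigma> x) \<le> (\<sigma> x + \<epsilon> * \<beta> x - \<sigma> x) * D2"
          unfolding D2_def using h \<epsilon> \<sigma>0 by (intro internal_energy_density_increment_le[OF chi]) auto
        then show ?thesis by (simp add: \<alpha>0 algebra_simps)
      next
        case 3
        then show ?thesis using \<open>\<And>x. x \<notin> E \<Longrightarrow> \<alpha>1 x = 0\<close> \<open>\<And>x. x \<notin> E \<Longrightarrow> \<alpha>2 x = 0\<close>
            \<open>\<And>x. x \<notin> Q \<Longrightarrow> \<beta>1 x = 0\<close> \<open>\<And>x. x \<notin> Q \<Longrightarrow> \<beta>2 x = 0\<close> by (simp add: \<alpha>_def \<beta>_def)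
      qed
      then show "chi (\<rho>' x + \<eta>' x) \<le> chi (\<rho> x + \<eta> x) - \<epsilon> * D1 * \<alpha> x + \<epsilon> * D2 * \<beta> x"
        unfolding \<sigma>' unfolding \<sigma>_def .
    qed
  qed
  have iR: "set_integrable lborel ?I (\<lambda>x. chi (\<rho> x + \<eta> x) - \<epsilon> * D1 * \<alpha> x + \<epsilon> * D2 * \<beta> x)"
    using ichi i\<alpha> i\<beta> by (intro set_integral_add set_integral_diff set_integrable_mult_right) auto
  have ichi': "set_integrable lborel ?I (\<lambda>x. chi (\<rho>' x + \<eta>' x))"
  proof -
    have c0: "set_integrable lborel ?I (\<lambda>x. \<bar>chi 0\<bar>)"
      by (rule set_integrable_interval_bounded[where B = "\<bar>chi 0\<bar>"]) auto
    have "set_integrable lborel ?I (\<lambda>x. \<bar>chi (\<rho> x + \<eta> x) - \<epsilon> * D1 * \<alpha> x + \<epsilon> * D2 * \<beta> x\<bar> + \<bar>chi 0\<bar>)"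
      by (intro set_integral_add set_integrable_abs iR c0)
    moreover have "(\<lambda>x. chi (max 0 (\<rho>' x + \<eta>' x))) \<in> borel_measurable borel"
      by (rule internal_energy_density_measurable[OF chi]) auto
    moreover have "AE x in lborel. x \<in> ?I \<longrightarrow> \<bar>chi (max 0 (\<rho>' x + \<eta>' x))\<bar> \<le> \<bar>chi (\<rho> x + \<eta> x) - \<epsilon> * D1 * \<alpha> x + \<epsilon> * D2 * \<beta> x\<bar> + \<bar>chi 0\<bar>"
      using pointwise
    proof eventually_elim
      case (elim x)
      show ?case
      proof
        assume x: "x \<in> ?I"
        have p: "0 \<le> \<rho>' x + \<eta>' x" using nonneg'[OF x] by simp
        then have "chi 0 \<le> chi (\<rho>' x + \<eta>' x)" by (intro internal_energy_density_mono[OF chi]) auto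
        with elim[rule_format, OF x]
        show "\<bar>chi (max 0 (\<rho>' x + \<eta>' x))\<bar> \<le> \<bar>chi (\<rho> x + \<eta> x) - \<epsilon> * D1 * \<alpha> x + \<epsilon> * D2 * \<beta> x\<bar> + \<bar>chi 0\<bar>"
          unfolding max_absorb2[OF p] by linarith
      qed
    qed
    ultimately have "set_integrable lborel ?I (\<lambda>x. chi (max 0 (\<rho>' x + \<eta>' x)))"
      unfolding set_integrable_def
      by (elim Bochner_Integration.integrable_bound) (auto elim!: eventually_mono simp: indicator_def)
    then show ?thesis using nonneg' 
      set_integrable_chi_cong[of ?I "\<lambda>x. \<rho>' x + \<eta>' x" lborel chi] by (auto simp: add_nonneg_nonneg)
  qed
  have "(\<integral>x\<in>?I. chi (\<rho>' x + \<eta>' x) \<partial>lborel) \<le> (\<integral>x\<in>?I. (chi (\<rho> x + \<eta> x) - \<epsilon> * D1 * \<alpha> x + \<epsilon> * D2 * \<beta> x) \<partial>lborel)"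
    by (rule set_integral_mono_AE[OF ichi' iR pointwise])
  also have "\<dots> = (\<integral>x\<in>?I. chi (\<rho> x + \<eta> x) \<partial>lborel) - \<epsilon> * D1 * m + \<epsilon> * D2 * m"
    using ichi i\<alpha> i\<beta> by (simp add: set_integral_add set_integral_diff m_def[symmetric] m\<beta>[symmetric])
  also have "\<dots> = (\<integral>x\<in>?I. chi (\<rho> x + \<eta> x) \<partial>lborel) - \<epsilon> * (D1 - D2) * m" by (simp add: algebra_simps)
  also have "\<dots> \<le> (\<integral>x\<in>?I. chi (\<rho> x + \<eta> x) \<partial>lborel) - \<epsilon> * (D1 - D2) * m0"
    using mm \<epsilon> D by (simp add: mult_left_mono)
  finally have Edrop: "(\<integral>x\<in>?I. chi (\<rho>' x + \<eta>' x) \<partial>lborel) \<le> (\<integral>x\<in>?I. chi (\<rho> x + \<eta> x) \<partial>lborel) - \<epsilon> * (D1 - D2) * m0" .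
  have "W2sq (dmeas a b \<rho>') (dmeas a b \<rho>h) + W2sq (dmeas a b \<eta>') (dmeas a b \<eta>h) \<le> ennreal (w1 + \<theta>) + ennreal (w2 + \<theta>)"
    using 1(11) 2(11) \<gamma>1(2) \<gamma>2(2) unfolding \<rho>'_def[abs_def] \<eta>'_def[abs_def] by (intro add_mono) auto
  also have "\<dots> = ennreal (w + 2 * \<theta>)" using w12 \<theta> ww by (simp flip: ennreal_plus)
  finally have W': "W2sq (dmeas a b \<rho>') (dmeas a b \<rho>h) + W2sq (dmeas a b \<eta>') (dmeas a b \<eta>h) \<le> ennreal (w + 2 * \<theta>)" .
  have c0: "0 \<le> w + 2 * \<theta>" using w \<theta> by simp
  from jko_minimiser_compare[OF min \<open>0 < \<tau>\<close> adm' W' c0 ichi'] obtain w' where "0 \<le> w'"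
    "W2sq (dmeas a b \<rho>) (dmeas a b \<rho>h) + W2sq (dmeas a b \<eta>) (dmeas a b \<eta>h) = ennreal w'"
    and le: "w' / (2 * \<tau>) + (\<integral>x\<in>?I. chi (\<rho> x + \<eta> x) \<partial>lborel)
      \<le> (w + 2 * \<theta>) / (2 * \<tau>) + (\<integral>x\<in>?I. chi (\<rho>' x + \<eta>' x) \<partial>lborel)" .
  then have "w' = w" using w by simp
  have "(w + 2 * \<theta>) / (2 * \<tau>) = w / (2 * \<tau>) + \<epsilon> * (D1 - D2) * m0 / 2"
    using \<open>0 < \<tau>\<close> by (simp add: \<theta>_def field_simps)
  moreover have "0 < \<epsilon> * (D1 - D2) * m0" using \<epsilon> D m0 by simp
  ultimately show False using le Edrop unfolding \<open>w' = w\<close> by linarith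
qed

lemma jko_maximum_principle:
  fixes \<rho>h \<eta>h :: "real \<Rightarrow> real"
  assumes "internal_energy_density chi" "0 < \<tau>" "0 < M"
    and "\<rho>h \<in> borel_measurable borel" "\<eta>h \<in> borel_measurable borel"
    and "\<And>x. x \<in> {a<..<b} \<Longrightarrow> 0 \<le> \<rho>h x" "\<And>x. x \<in> {a<..<b} \<Longrightarrow> 0 \<le> \<eta>h x"
    and "AE x in lborel. x \<in> {a<..<b} \<longrightarrow> \<rho>h x + \<eta>h x \<le> M"
    and min: "jko_minimiser a b chi \<tau> \<rho>h \<eta>h \<rho> \<eta>"
  shows "AE x in lborel. x \<in> {a<..<b} \<longrightarrow> \<rho> x + \<eta> x \<le> M"
proof -
  have [measurable]: "\<rho> \<in> borel_measurable borel" "\<eta> \<in> borel_measurable borel"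
    using min unfolding jko_minimiser_def Let_def admissible_def by auto
  have "AE x in lborel. \<not> (x \<in> {a<..<b} \<and> M + inverse (real (Suc n)) \<le> \<rho> x + \<eta> x)" for n
  proof (rule AE_I')
    let ?S = "{x\<in>{a<..<b}. M + inverse (real (Suc n)) \<le> \<rho> x + \<eta> x}"
    have "measure lborel ?S = 0"
      by (rule jko_level_set_null[OF assms(1-3) _ assms(4-)]) auto
    moreover have "emeasure lborel ?S \<le> emeasure lborel {a<..<b}" by (rule emeasure_mono) auto
    then have "emeasure lborel ?S \<noteq> \<infinity>" using emeasure_bounded_finite[of "{a<..<b}"] by (auto simp: top_unique)
    ultimately show "?S \<in> null_sets lborel" by (intro null_setsI) (auto simp: emeasure_eq_ennreal_measure)
  qed auto
  then have "AE x in lborel. \<forall>n. \<not> (x \<in> {a<..<b} \<and> M + inverse (real (Suc n)) \<le> \<rho> x + \<eta> x)"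
    unfolding AE_all_countable by blast
  then show ?thesis
  proof eventually_elim
    case (elim x)
    show ?case
    proof (intro impI, rule ccontr)
      assume "x \<in> {a<..<b}" "\<not> \<rho> x + \<eta> x \<le> M"
      moreover from this obtain n where "inverse (real (Suc n)) < \<rho> x + \<eta> x - M"
        using reals_Archimedean[of "\<rho> x + \<eta> x - M"] by auto
      ultimately show False using elim[rule_format, of n] by auto
    qed
  qed
qed

section \<open>The splitting scheme\<close>

lemma set_integral_interval_const:
  fixes c :: real
  assumes "a \<le> b"
  shows "(\<integral>x\<in>{a<..<b}. c \<partial>lborel) = (b - a) * c"
  using assms by (simp add: set_lebesgue_integral_def)

lemma set_integrable_interval_const: "set_integrable lborel {a<..<b} (\<lambda>x::real. c :: real)"
  by (rule set_integrable_interval_bounded[where B = "\<bar>c\<bar>"]) auto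

lemma internal_energy_bounds:
  fixes f :: "real \<Rightarrow> real"
  assumes chi: "internal_energy_density chi" and "a \<le> b" and "f \<in> borel_measurable borel"
    and nonneg: "\<And>x. x \<in> {a<..<b} \<Longrightarrow> 0 \<le> f x"
    and bound: "AE x in lborel. x \<in> {a<..<b} \<longrightarrow> f x \<le> M"
  shows "(b - a) * chi 0 \<le> (\<integral>x\<in>{a<..<b}. chi (f x) \<partial>lborel)"
    and "(\<integral>x\<in>{a<..<b}. chi (f x) \<partial>lborel) \<le> (b - a) * chi M"
proof -
  note int = internal_energy_integrable[OF assms(1,3) nonneg bound] set_integrable_interval_const[of a b]
  have "(\<integral>x\<in>{a<..<b}. chi 0 \<partial>lborel) \<le> (\<integral>x\<in>{a<..<b}. chi (f x) \<partial>lborel)"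
    using int nonneg by (intro set_integral_mono) (auto intro: internal_energy_density_mono[OF chi])
  then show "(b - a) * chi 0 \<le> (\<integral>x\<in>{a<..<b}. chi (f x) \<partial>lborel)"
    by (simp add: set_integral_interval_const[OF \<open>a \<le> b\<close>])
  have "(\<integral>x\<in>{a<..<b}. chi (f x) \<partial>lborel) \<le> (\<integral>x\<in>{a<..<b}. chi M \<partial>lborel)"
  proof (rule set_integral_mono_AE)
    show "AE x\<in>{a<..<b} in lborel. chi (f x) \<le> chi M"
      using bound by eventually_elim (use nonneg in \<open>auto intro: internal_energy_density_mono[OF chi]\<close>)
  qed (use int in auto)
  then show "(\<integral>x\<in>{a<..<b}. chi (f x) \<partial>lborel) \<le> (b - a) * chi M"
    by (simp add: set_integral_interval_const[OF \<open>a \<le> b\<close>])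
qed

lemma jko_minimiser_cong:
  assumes "\<And>x. x \<in> {a<..<b} \<Longrightarrow> \<rho>h x = \<rho>h' x" "\<And>x. x \<in> {a<..<b} \<Longrightarrow> \<eta>h x = \<eta>h' x"
  shows "jko_minimiser a b chi \<tau> \<rho>h \<eta>h \<rho> \<eta> \<longleftrightarrow> jko_minimiser a b chi \<tau> \<rho>h' \<eta>h' \<rho> \<eta>"
proof -
  have "(\<integral>x\<in>{a<..<b}. \<rho>h x \<partial>lborel) = (\<integral>x\<in>{a<..<b}. \<rho>h' x \<partial>lborel)"
    "(\<integral>x\<in>{a<..<b}. \<eta>h x \<partial>lborel) = (\<integral>x\<in>{a<..<b}. \<eta>h' x \<partial>lborel)"
    using assms by (auto intro!: set_lebesgue_integral_cong)
  moreover have "dmeas a b \<rho>h = dmeas a b \<rho>h'" "dmeas a b \<eta>h = dmeas a b \<eta>h'"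
    using assms by (auto intro!: dmeas_cong)
  ultimately show ?thesis by (simp add: jko_minimiser_def jko_functional_def)
qed

lemma exp_minus_one_le: "exp x - 1 \<le> x * exp (x :: real)"
proof -
  have "(1 - x) * exp x \<le> exp (- x) * exp x"
    using exp_ge_add_one_self[of "- x"] by (intro mult_right_mono) auto
  then show ?thesis by (simp add: algebra_simps flip: exp_add)
qed

lemma borel_measurable_interval_extension:
  fixes f :: "real \<Rightarrow> real"
  assumes "f \<in> borel_measurable (restrict_space borel {a..b})"
  shows "(\<lambda>x. indicator {a..b} x * f x) \<in> borel_measurable borel"
  using assms by (simp add: borel_measurable_restrict_space_iff)

lemma splitting_step:
  fixes sg r sh rh :: "real \<Rightarrow> real"
  assumes chi: "internal_energy_density chi" and "a < b"
    and F: "\<forall>F\<in>{F1, F2, G1, G2}. bounded (F ` ({0..} \<times> {0..})) \<and> (\<exists>L. L-lipschitz_on ({0..} \<times> {0..}) F)"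
    and B: "\<forall>F\<in>{F1, F2, G1, G2}. \<forall>p\<in>{0..} \<times> {0..}. \<bar>F p\<bar> \<le> B"
    and "0 \<le> B" and \<tau>: "0 < \<tau>" "\<tau> < 1" and "0 < M" and Ms: "M * exp (2 * B * \<tau>) \<le> Ms"
    and msg: "sg \<in> borel_measurable (restrict_space borel {a..b})"
    and mr: "r \<in> borel_measurable (restrict_space borel {a..b})"
    and bound: "AE x in lborel. x \<in> {a<..<b} \<longrightarrow> sg x \<le> M"
    and react: "\<And>x. x \<in> {a..b} \<Longrightarrow> reaction_step F1 F2 G1 G2 \<tau> (sg x) (r x) (sh x) (rh x)"
    and min: "jko_minimiser a b chi \<tau> (\<lambda>x. rh x * sh x) (\<lambda>x. (1 - rh x) * sh x) \<rho> \<eta>"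
  shows "rh \<in> borel_measurable (restrict_space borel {a..b})"
    and "AE x in lborel. x \<in> {a<..<b} \<longrightarrow> \<rho> x + \<eta> x \<le> M * exp (2 * B * \<tau>)"
    and "\<exists>w\<ge>0. W2sq (dmeas a b (\<lambda>x. rh x * sh x)) (dmeas a b \<rho>)
        + W2sq (dmeas a b (\<lambda>x. (1 - rh x) * sh x)) (dmeas a b \<eta>) = ennreal w
      \<and> w / (2 * \<tau>) + (\<integral>x\<in>{a<..<b}. chi (\<rho> x + \<eta> x) \<partial>lborel)
        \<le> (\<integral>x\<in>{a<..<b}. chi (sg x) \<partial>lborel) + (b - a) * (Ms * (2 * B * exp (2 * B)) * deriv chi Ms) * \<tau>"
proof -
  let ?I = "{a<..<b}" and ?M = "M * exp (2 * B * \<tau>)"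
  note rD = reaction_stepD[OF react less_imp_le[OF \<tau>(1)] B]
  have sp: "space (restrict_space borel {a..b}) = {a..b}" by (simp add: space_restrict_space)
  note m = reaction_step_measurable[OF F B \<open>0 \<le> B\<close> less_imp_le[OF \<tau>(1)] msg mr, of sh rh, unfolded sp, OF react]
  show "rh \<in> borel_measurable (restrict_space borel {a..b})" by (rule m(2))
  define \<rho>h where "\<rho>h x = indicator {a..b} x * (rh x * sh x)" for x
  define \<eta>h where "\<eta>h x = indicator {a..b} x * ((1 - rh x) * sh x)" for x
  have m\<rho> [measurable]: "\<rho>h \<in> borel_measurable borel"
    unfolding \<rho>h_def[abs_def] using m by (intro borel_measurable_interval_extension borel_measurable_times) auto
  have m\<eta> [measurable]: "\<eta>h \<in> borel_measurable borel"
    unfolding \<eta>h_def[abs_def] using m by (intro borel_measurable_interval_extension borel_measurable_times borel_measurable_diff) auto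
  have eq: "\<rho>h x = rh x * sh x" "\<eta>h x = (1 - rh x) * sh x" if "x \<in> ?I" for x
    using that by (auto simp: \<rho>h_def \<eta>h_def)
  have sum: "\<rho>h x + \<eta>h x = sh x" if "x \<in> ?I" for x
    using eq[OF that] by (simp add: algebra_simps)
  have min': "jko_minimiser a b chi \<tau> \<rho>h \<eta>h \<rho> \<eta>"
    using jko_minimiser_cong[of a b \<rho>h "\<lambda>x. rh x * sh x" \<eta>h "\<lambda>x. (1 - rh x) * sh x"] eq min by auto
  have nonneg: "0 \<le> \<rho>h x" "0 \<le> \<eta>h x" "0 \<le> sg x" "0 \<le> sh x" "sh x \<le> sg x * exp (2 * B * \<tau>)" if "x \<in> ?I" for x
    using rD[of x] eq[OF that] that by auto
  have boundh: "AE x in lborel. x \<in> ?I \<longrightarrow> \<rho>h x + \<eta>h x \<le> ?M"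
    using bound
  proof eventually_elim
    case (elim x)
    show ?case
    proof
      assume x: "x \<in> ?I"
      have "sh x \<le> sg x * exp (2 * B * \<tau>)" by (rule nonneg(5)[OF x])
      also have "\<dots> \<le> ?M" using elim x by (intro mult_right_mono) auto
      finally show "\<rho>h x + \<eta>h x \<le> ?M" by (simp add: sum[OF x])
    qed
  qed
  have "0 < ?M" using \<open>0 < M\<close> by simp
  from jko_maximum_principle[OF chi \<tau>(1) this m\<rho> m\<eta> nonneg(1,2) boundh min']
  show "AE x in lborel. x \<in> ?I \<longrightarrow> \<rho> x + \<eta> x \<le> ?M" by simp
  obtain w where w: "0 \<le> w" "W2sq (dmeas a b \<rho>) (dmeas a b \<rho>h) + W2sq (dmeas a b \<eta>) (dmeas a b \<eta>h) = ennreal w"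
    "w / (2 * \<tau>) + (\<integral>x\<in>?I. chi (\<rho> x + \<eta> x) \<partial>lborel) \<le> (\<integral>x\<in>?I. chi (\<rho>h x + \<eta>h x) \<partial>lborel)"
    by (rule jko_energy_dissipation[OF chi \<tau>(1) m\<rho> m\<eta> _ _ boundh min']) (use nonneg in auto)
  define K where "K = Ms * (2 * B * exp (2 * B)) * deriv chi Ms"
  define sg' where "sg' x = indicator {a..b} x * sg x" for x
  have msg' [measurable]: "sg' \<in> borel_measurable borel"
    unfolding sg'_def[abs_def] by (rule borel_measurable_interval_extension[OF msg])
  have sg': "sg' x = sg x" if "x \<in> ?I" for x using that by (auto simp: sg'_def)
  have M0: "0 < Ms" "M \<le> Ms"
  proof -
    show "0 < Ms" using \<open>0 < ?M\<close> Ms by linarith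
    have "M * 1 \<le> ?M" using \<open>0 \<le> B\<close> \<tau> \<open>0 < M\<close> by (intro mult_left_mono) auto
    then show "M \<le> Ms" using Ms by linarith
  qed
  have "(\<integral>x\<in>?I. chi (\<rho>h x + \<eta>h x) \<partial>lborel) \<le> (\<integral>x\<in>?I. (chi (sg' x) + K * \<tau>) \<partial>lborel)"
  proof (rule set_integral_mono_AE)
    show "set_integrable lborel ?I (\<lambda>x. chi (\<rho>h x + \<eta>h x))"
      by (rule internal_energy_integrable[OF chi _ _ boundh]) (use nonneg in auto)
    have "set_integrable lborel ?I (\<lambda>x. chi (sg' x))"
      by (rule internal_energy_integrable[OF chi msg', where M = M]) (use bound nonneg(3) sg' in auto)
    then show "set_integrable lborel ?I (\<lambda>x. chi (sg' x) + K * \<tau>)"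
      by (intro set_integral_add set_integrable_interval_const)
    show "AE x\<in>?I in lborel. chi (\<rho>h x + \<eta>h x) \<le> chi (sg' x) + K * \<tau>"
      using bound boundh
    proof eventually_elim
      case (elim x)
      show ?case
      proof
        assume x: "x \<in> ?I"
        have D: "0 < deriv chi Ms" by (rule internal_energy_densityD(4)[OF chi M0(1)])
        have K0: "0 \<le> K * \<tau>" using D M0 \<open>0 \<le> B\<close> \<tau> by (simp add: K_def)
        show "chi (\<rho>h x + \<eta>h x) \<le> chi (sg' x) + K * \<tau>"
        proof (cases "sh x \<le> sg x")
          case True
          then have "chi (sh x) \<le> chi (sg x)" by (intro internal_energy_density_mono[OF chi] nonneg(4)[OF x])
          then show ?thesis using K0 by (simp add: sum[OF x] sg'[OF x])
        next
          case False
          have "sh x \<le> Ms" using elim x Ms sum[OF x] by auto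
          then have "chi (sh x) - chi (sg x) \<le> (sh x - sg x) * deriv chi Ms"
            using False nonneg(3)[OF x] by (intro internal_energy_density_increment_le[OF chi]) auto
          also have "\<dots> \<le> (Ms * (2 * B * \<tau> * exp (2 * B))) * deriv chi Ms"
          proof (intro mult_right_mono)
            have "sh x - sg x \<le> sg x * (exp (2 * B * \<tau>) - 1)" using nonneg(5)[OF x] by (simp add: algebra_simps)
            also have "\<dots> \<le> sg x * (2 * B * \<tau> * exp (2 * B * \<tau>))"
              using nonneg(3)[OF x] exp_minus_one_le by (intro mult_left_mono) auto
            also have "\<dots> \<le> Ms * (2 * B * \<tau> * exp (2 * B))"
              using nonneg(3)[OF x] elim x M0 \<open>0 \<le> B\<close> \<tau>
              by (intro mult_mono mult_left_mono) (auto intro: mult_left_le mult_nonneg_nonneg)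
            finally show "sh x - sg x \<le> Ms * (2 * B * \<tau> * exp (2 * B))" .
          qed (use D in simp)
          also have "\<dots> = K * \<tau>" by (simp add: K_def)
          finally show ?thesis by (simp add: sum[OF x] sg'[OF x])
        qed
      qed
    qed
  qed
  also have "\<dots> = (\<integral>x\<in>?I. chi (sg' x) \<partial>lborel) + (b - a) * (K * \<tau>)"
  proof -
    have "set_integrable lborel ?I (\<lambda>x. chi (sg' x))"
      by (rule internal_energy_integrable[OF chi msg', where M = M]) (use bound nonneg(3) sg' in auto)
    then show ?thesis using \<open>a < b\<close>
      by (subst set_integral_add(2)) (auto simp: set_integral_interval_const intro: set_integrable_interval_const)
  qed
  also have "(\<integral>x\<in>?I. chi (sg' x) \<partial>lborel) = (\<integral>x\<in>?I. chi (sg x) \<partial>lborel)"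
    using sg' by (intro set_lebesgue_integral_cong) auto
  finally have "w / (2 * \<tau>) + (\<integral>x\<in>?I. chi (\<rho> x + \<eta> x) \<partial>lborel) \<le> (\<integral>x\<in>?I. chi (sg x) \<partial>lborel) + (b - a) * K * \<tau>"
    using w(3) by simp
  moreover have "dmeas a b \<rho>h = dmeas a b (\<lambda>x. rh x * sh x)" "dmeas a b \<eta>h = dmeas a b (\<lambda>x. (1 - rh x) * sh x)"
    using eq by (auto intro!: dmeas_cong)
  ultimately show "\<exists>w\<ge>0. W2sq (dmeas a b (\<lambda>x. rh x * sh x)) (dmeas a b \<rho>)
        + W2sq (dmeas a b (\<lambda>x. (1 - rh x) * sh x)) (dmeas a b \<eta>) = ennreal w
      \<and> w / (2 * \<tau>) + (\<integral>x\<in>?I. chi (\<rho> x + \<eta> x) \<partial>lborel)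
        \<le> (\<integral>x\<in>?I. chi (sg x) \<partial>lborel) + (b - a) * (Ms * (2 * B * exp (2 * B)) * deriv chi Ms) * \<tau>"
    using w(1,2) unfolding K_def by (intro exI[of _ w]) (simp add: W2sq_commute)
qed

theorem mainTheorem13:
  fixes a b T :: real and chi :: "real \<Rightarrow> real"
    and F1 F2 G1 G2 :: "real \<times> real \<Rightarrow> real"
    and \<rho>0 \<eta>0 r0 :: "real \<Rightarrow> real"
  assumes "a < b" and "T > 0"
    and "internal_energy_density chi"
    and "\<forall>F\<in>{F1, F2, G1, G2}. bounded (F ` ({0..} \<times> {0..})) \<and> (\<exists>L. L-lipschitz_on ({0..} \<times> {0..}) F)"
    and "\<forall>\<eta>\<ge>0. G1 (0, \<eta>) \<ge> 0" and "\<forall>\<rho>\<ge>0. G2 (\<rho>, 0) \<ge> 0"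
    and "has_bv a b \<rho>0" and "has_bv a b \<eta>0" and "has_bv a b r0"
    and "\<exists>M. \<forall>x\<in>{a..b}. \<bar>\<rho>0 x\<bar> \<le> M \<and> \<bar>\<eta>0 x\<bar> \<le> M"
    and "\<forall>x\<in>{a..b}. 0 \<le> \<rho>0 x \<and> 0 \<le> \<eta>0 x \<and> 0 \<le> r0 x \<and> r0 x \<le> 1"
    and "\<forall>x\<in>{a..b}. \<rho>0 x + \<eta>0 x > 0 \<longrightarrow> r0 x = \<rho>0 x / (\<rho>0 x + \<eta>0 x)"
  shows "\<exists>C. \<forall>\<tau> N sig r sigh rh rhoD etaD Tm.
           0 < \<tau> \<and> \<tau> < 1 \<and> real N * \<tau> = T \<and>
           splitting_scheme a b chi F1 F2 G1 G2 \<rho>0 \<eta>0 r0 \<tau> N sig r sigh rh rhoD etaD Tm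
           \<longrightarrow> ennreal (1 / (2 * \<tau>)) *
                 (\<Sum>n<N. W2sq (dmeas a b (\<lambda>x. rh n x * sigh n x)) (dmeas a b (rhoD n))
                        + W2sq (dmeas a b (\<lambda>x. (1 - rh n x) * sigh n x)) (dmeas a b (etaD n)))
               \<le> ennreal C"
proof -
  let ?I = "{a<..<b}"
  note chi = assms(3) and F = assms(4)
  have "bounded (\<Union>F\<in>{F1, F2, G1, G2}. F ` ({0..} \<times> {0..}))"
    using F by (intro bounded_UN) auto
  then obtain B0 where B0: "\<And>y. y \<in> (\<Union>F\<in>{F1, F2, G1, G2}. F ` ({0..} \<times> {0..})) \<Longrightarrow> norm y \<le> B0"
    unfolding bounded_iff by blast
  define B where "B = max B0 0"
  have B: "\<forall>F\<in>{F1, F2, G1, G2}. \<forall>p\<in>{0..} \<times> {0..}. \<bar>F p\<bar> \<le> B"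
  proof (intro ballI)
    fix F and p :: "real \<times> real" assume "F \<in> {F1, F2, G1, G2}" "p \<in> {0..} \<times> {0..}"
    then have "norm (F p) \<le> B0" by (intro B0) blast
    then show "\<bar>F p\<bar> \<le> B" by (simp add: B_def)
  qed
  have "0 \<le> B" by (simp add: B_def)
  obtain M1 where M1: "\<And>x. x \<in> {a..b} \<Longrightarrow> \<bar>\<rho>0 x\<bar> \<le> M1 \<and> \<bar>\<eta>0 x\<bar> \<le> M1" using assms(10) by blast
  define M0 where "M0 = 2 * \<bar>M1\<bar> + 1"
  have "0 < M0" by (simp add: M0_def)
  define Ms where "Ms = M0 * exp (2 * B * T)"
  define K where "K = (b - a) * (Ms * (2 * B * exp (2 * B)) * deriv chi Ms)"
  define C where "C = (b - a) * chi M0 - (b - a) * chi 0 + K * T"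
  show ?thesis
  proof (intro exI[of _ C] allI impI, elim conjE)
    fix \<tau> N sig r sigh rh rhoD etaD Tm
    assume \<tau>: "0 < \<tau>" "\<tau> < 1" and NT: "real N * \<tau> = T"
      and scheme: "splitting_scheme a b chi F1 F2 G1 G2 \<rho>0 \<eta>0 r0 \<tau> N sig r sigh rh rhoD etaD Tm"
    define Mn where "Mn n = M0 * exp (2 * B * \<tau>) ^ n" for n
    have Mn: "0 < Mn n" "Mn n * exp (2 * B * \<tau>) = Mn (Suc n)" for n
      using \<open>0 < M0\<close> by (auto simp: Mn_def)
    have Mn_le: "Mn n \<le> Ms" if "n \<le> N" for n
    proof -
      have "exp (2 * B * \<tau>) ^ n \<le> exp (2 * B * \<tau>) ^ N"
        using that \<open>0 \<le> B\<close> \<tau> by (intro power_increasing) auto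
      also have "\<dots> = exp (2 * B * T)"
        by (simp add: NT[symmetric] exp_of_nat_mult[symmetric] ac_simps)
      finally show ?thesis using \<open>0 < M0\<close> by (simp add: Mn_def Ms_def)
    qed
    define E where "E n = (\<integral>x\<in>?I. chi (sig n x) \<partial>lborel)" for n
    define W where "W n = W2sq (dmeas a b (\<lambda>x. rh n x * sigh n x)) (dmeas a b (rhoD n))
      + W2sq (dmeas a b (\<lambda>x. (1 - rh n x) * sigh n x)) (dmeas a b (etaD n))" for n
    define P where "P n \<longleftrightarrow> sig n \<in> borel_measurable (restrict_space borel {a..b}) \<and>
      r n \<in> borel_measurable (restrict_space borel {a..b}) \<and> (\<forall>x\<in>?I. 0 \<le> sig n x) \<and>
      (AE x in lborel. x \<in> ?I \<longrightarrow> sig n x \<le> Mn n)" for n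
    have init: "sig 0 x = \<rho>0 x + \<eta>0 x" "r 0 x = r0 x" if "x \<in> {a..b}" for x
      using scheme that unfolding splitting_scheme_def by auto
    have P0: "P 0"
      unfolding P_def
    proof (intro conjI ballI)
      note bv = has_bv_borel_measurable[OF assms(7)] has_bv_borel_measurable[OF assms(8)] has_bv_borel_measurable[OF assms(9)]
      show "sig 0 \<in> borel_measurable (restrict_space borel {a..b})"
        by (rule measurable_cong[THEN iffD2, OF _ borel_measurable_add[OF bv(1,2)]])
          (auto simp: space_restrict_space init)
      show "r 0 \<in> borel_measurable (restrict_space borel {a..b})"
        by (rule measurable_cong[THEN iffD2, OF _ bv(3)]) (auto simp: space_restrict_space init)
      show "0 \<le> sig 0 x" if "x \<in> ?I" for x using that assms(11) by (auto simp: init)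
      show "AE x in lborel. x \<in> ?I \<longrightarrow> sig 0 x \<le> Mn 0"
      proof (intro AE_I2 impI)
        fix x assume "x \<in> ?I"
        then show "sig 0 x \<le> Mn 0" using M1[of x] init[of x] by (auto simp: Mn_def M0_def)
      qed
    qed
    have step: "P (Suc n) \<and> (\<exists>w\<ge>0. W n = ennreal w \<and> w / (2 * \<tau>) + E (Suc n) \<le> E n + K * \<tau>)"
      if "n < N" and "P n" for n
    proof -
      have react: "\<And>x. x \<in> {a..b} \<Longrightarrow> reaction_step F1 F2 G1 G2 \<tau> (sig n x) (r n x) (sigh n x) (rh n x)"
        and min: "jko_minimiser a b chi \<tau> (\<lambda>x. rh n x * sigh n x) (\<lambda>x. (1 - rh n x) * sigh n x) (rhoD n) (etaD n)"
        and sig: "\<And>x. x \<in> {a..b} \<Longrightarrow> sig (Suc n) x = rhoD n x + etaD n x"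
        and ot: "monotone_ot_map a b (sig (Suc n)) (sigh n) (Tm n)"
        and r: "\<And>x. x \<in> {a..b} \<Longrightarrow> r (Suc n) x = rh n (Tm n x)"
        using scheme \<open>n < N\<close> unfolding splitting_scheme_def by auto
      have Ms: "Mn n * exp (2 * B * \<tau>) \<le> Ms" using Mn_le[of "Suc n"] \<open>n < N\<close> by (simp add: Mn)
      note p = \<open>P n\<close>[unfolded P_def]
      note st = splitting_step[OF chi \<open>a < b\<close> F B \<open>0 \<le> B\<close> \<tau> Mn(1) Ms _ _ _ react min]
      have D: "rhoD n \<in> borel_measurable borel" "etaD n \<in> borel_measurable borel"
        "\<And>x. x \<in> ?I \<Longrightarrow> 0 \<le> rhoD n x" "\<And>x. x \<in> ?I \<Longrightarrow> 0 \<le> etaD n x"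
        using min unfolding jko_minimiser_def Let_def admissible_def by auto
      have "P (Suc n)"
        unfolding P_def
      proof (intro conjI ballI)
        show "sig (Suc n) \<in> borel_measurable (restrict_space borel {a..b})"
          by (rule measurable_cong[THEN iffD2, OF _ measurable_restrict_space1[OF borel_measurable_add[OF D(1,2)]]])
            (auto simp: space_restrict_space sig)
        have "Tm n \<in> measurable (restrict_space borel {a..b}) (restrict_space borel {a..b})"
          using ot unfolding monotone_ot_map_def
          by (intro measurable_restrict_space2 measurable_restrict_space1) (auto simp: space_restrict_space)
        moreover have "rh n \<in> borel_measurable (restrict_space borel {a..b})"
          by (rule st(1)) (use p in auto)
        ultimately have "(\<lambda>x. rh n (Tm n x)) \<in> borel_measurable (restrict_space borel {a..b})"
          by (rule measurable_compose)
        then show "r (Suc n) \<in> borel_measurable (restrict_space borel {a..b})"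
          by (rule measurable_cong[THEN iffD2, rotated]) (auto simp: space_restrict_space r)
        show "0 \<le> sig (Suc n) x" if "x \<in> ?I" for x using D(3,4)[OF that] that sig[of x] by auto
        have "AE x in lborel. x \<in> ?I \<longrightarrow> rhoD n x + etaD n x \<le> Mn n * exp (2 * B * \<tau>)"
          by (rule st(2)) (use p in auto)
        then show "AE x in lborel. x \<in> ?I \<longrightarrow> sig (Suc n) x \<le> Mn (Suc n)"
          by eventually_elim (auto simp: sig Mn)
      qed
      moreover have "(\<integral>x\<in>?I. chi (rhoD n x + etaD n x) \<partial>lborel) = E (Suc n)"
        unfolding E_def by (rule set_lebesgue_integral_cong) (auto simp: sig)
      moreover have "\<exists>w\<ge>0. W n = ennreal w \<and> w / (2 * \<tau>) + (\<integral>x\<in>?I. chi (rhoD n x + etaD n x) \<partial>lborel) \<le> E n + K * \<tau>"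
        unfolding W_def E_def K_def by (rule st(3)) (use p in auto)
      ultimately show ?thesis by simp
    qed
    have P: "P n" if "n \<le> N" for n
      using that by (induction n) (auto simp: P0 step)
    have "\<exists>w\<ge>0. W n = ennreal w \<and> w / (2 * \<tau>) + E (Suc n) \<le> E n + K * \<tau>" if "n < N" for n
      using step[OF that P] that by auto
    then obtain w where w: "\<And>n. n < N \<Longrightarrow> 0 \<le> w n \<and> W n = ennreal (w n) \<and> w n / (2 * \<tau>) + E (Suc n) \<le> E n + K * \<tau>"
      by metis
    have tele: "(\<Sum>i<n. w i) / (2 * \<tau>) + E n \<le> E 0 + real n * (K * \<tau>)" if "n \<le> N" for n
      using that
    proof (induction n)
      case (Suc n)
      then have "(\<Sum>i<n. w i) / (2 * \<tau>) + E n \<le> E 0 + real n * (K * \<tau>)" by simp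
      moreover have "w n / (2 * \<tau>) + E (Suc n) \<le> E n + K * \<tau>" using w[of n] Suc by simp
      ultimately show ?case by (simp add: add_divide_distrib algebra_simps)
    qed simp
    have Eb: "(b - a) * chi 0 \<le> E n" "E n \<le> (b - a) * chi (Mn n)" if "n \<le> N" for n
    proof -
      define s where "s x = indicator {a..b} x * sig n x" for x
      have "s \<in> borel_measurable borel"
        unfolding s_def[abs_def] using P[OF that] by (intro borel_measurable_interval_extension) (simp add: P_def)
      moreover have s: "s x = sig n x" if "x \<in> ?I" for x using that by (auto simp: s_def)
      moreover have "\<And>x. x \<in> ?I \<Longrightarrow> 0 \<le> s x" using P[OF that] s by (simp add: P_def)
      moreover have "AE x in lborel. x \<in> ?I \<longrightarrow> s x \<le> Mn n" using P[OF that] s by (simp add: P_def)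
      moreover have "(\<integral>x\<in>?I. chi (s x) \<partial>lborel) = E n"
        unfolding E_def using s by (intro set_lebesgue_integral_cong) auto
      ultimately show "(b - a) * chi 0 \<le> E n" "E n \<le> (b - a) * chi (Mn n)"
        using internal_energy_bounds[OF chi less_imp_le[OF \<open>a < b\<close>], of s "Mn n"] by auto
    qed
    have "(\<Sum>i<N. w i) / (2 * \<tau>) \<le> C"
    proof -
      have "real N * (K * \<tau>) = K * T" by (simp add: NT[symmetric])
      moreover have "E 0 \<le> (b - a) * chi M0" using Eb(2)[of 0] by (simp add: Mn_def)
      ultimately show ?thesis
        using tele[of N] Eb(1)[of N] unfolding C_def by linarith
    qed
    moreover have "(\<Sum>n<N. W n) = ennreal (\<Sum>n<N. w n)"
      using w by (subst sum_ennreal[symmetric]) (auto intro!: sum.cong)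
    then have "ennreal (1 / (2 * \<tau>)) * (\<Sum>n<N. W n) = ennreal ((\<Sum>n<N. w n) / (2 * \<tau>))"
      using \<tau> sum_nonneg[of "{..<N}" w] w by (simp add: ennreal_mult[symmetric])
    ultimately show "ennreal (1 / (2 * \<tau>)) *
                 (\<Sum>n<N. W2sq (dmeas a b (\<lambda>x. rh n x * sigh n x)) (dmeas a b (rhoD n))
                        + W2sq (dmeas a b (\<lambda>x. (1 - rh n x) * sigh n x)) (dmeas a b (etaD n)))
               \<le> ennreal C"
      unfolding W_def[symmetric] by (simp add: ennreal_leI)
  qed
qed

end
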